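(* Let $X$ be a compact geodesic space and let $f:Y\to X$ be a covering map, where $Y$ is connected and has the lifted geodesic metric from $X$. Let $\varepsilon>0$ be such that there is a covering map $g:X_\varepsilon\to Y$ with $\phi_\varepsilon=f\circ g$. Define a subgroup $K$ of $\pi_\varepsilon(X)$ by $$K:=\{[\lambda]_\varepsilon:\ \exists\,\kappa\in[\lambda]_\varepsilon\text{ such that some stringing }\widehat\kappa\text{ of }\kappa\text{ lifts as a loop in }Y\}.$$ Then: 1. $K=\{[\lambda]_\varepsilon:\text{ for all }\kappa\in[\lambda]_\varepsilon\text{, every stringing }\widehat\kappa\text{ of }\kappa\text{ lifts as a loop to }Y\}$. 2. There is a covering equivalence $\phi:Y\to X_\varepsilon/K$ such that $\pi=\phi\circ g$, where $\pi:X_\varepsilon\to X_\varepsilon/K$ is the quotient map. 3. $K$ is a normal subgroup of $\pi_\varepsilon(X)$ if and only if $f$ is a regular covering map.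
   Context: A geodesic space is a metric space in which any two points are joined by a geodesic (an arclength-parameterized path whose length equals the distance between its endpoints). All spaces have a base point $*$ and all maps ($f$, $g$, $\phi_\varepsilon$) are base-point preserving; "lifts as a loop in $Y$" means that the lift starting at the base point of $Y$ is a loop. The lifted geodesic metric on $Y$ is $d(x,y)=\inf\{L(f\circ c): c\text{ a path joining }x\text{ and }y\}$. For $\varepsilon>0$, an $\varepsilon$-chain in $X$ is a finite sequence $\{x_0,\dots,x_n\}$ with $d(x_i,x_{i+1})<\varepsilon$ for all $i$. An $\varepsilon$-homotopy is a finite sequence of $\varepsilon$-chains, each obtained from its predecessor by adding or removing a single point, endpoints always fixed; $[\alpha]_\varepsilon$ is the $\varepsilon$-homotopy class of $\alpha$. $X_\varepsilon$ is the set of all $[\alpha]_\varepsilon$ with $\alpha$ an $\varepsilon$-chain starting at $*$, with base point $[*]_\varepsilon$ and metric $d([\alpha]_\varepsilon,[\beta]_\varepsilon)=\inf\{L(\gamma):\gamma\in[\overline\alpha*\beta]_\varepsilon\}$, where $L(\{x_0,\dots,x_n\})=\sum_i d(x_{i-1},x_i)$, $\overline\alpha$ is the reversal and $*$ between chains is concatenation. $\phi_\varepsilon:X_\varepsilon\to X$ is the endpoint map, a regular covering map. $\pi_\varepsilon(X)\subset X_\varepsilon$ is the group of classes of $\varepsilon$-loops based at $*$ under concatenation; it acts on $X_\varepsilon$ by preconcatenation as the deck group of $\phi_\varepsilon$. A stringing $\widehat\alpha$ of an $\varepsilon$-chain $\alpha=\{x_0,\dots,x_n\}$ is a path formed by concatenating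 paths $\gamma_i$ from $x_i$ to $x_{i+1}$, each $\gamma_i$ lying entirely in the open ball $B(x_i,\varepsilon)$. The natural covering map $\xi:X_\varepsilon/K\to X$ is $\xi(K[\alpha]_\varepsilon)=\phi_\varepsilon([\alpha]_\varepsilon)$; that $\phi$ is a covering equivalence means $\phi$ is a homeomorphism with $\xi\circ\phi=f$. *)

theory Defs
  imports "HOL-Analysis.Analysis" "HOL-Algebra.Coset"
begin

section \<open>Chains, curve length and geodesic spaces\<close>

definition chain_length :: "'a metric \<Rightarrow> 'a list \<Rightarrow> real" where
  "chain_length X xs = sum_list (map2 (mdist X) xs (tl xs))"

definition curve_length :: "'a metric \<Rightarrow> (real \<Rightarrow> 'a) \<Rightarrow> real \<Rightarrow> real \<Rightarrow> ennreal" where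
  "curve_length X c a b =
     (SUP ts \<in> {ts. sorted ts \<and> set ts \<subseteq> {a..b}}. ennreal (chain_length X (map c ts)))"

definition geodesic_from_to :: "'a metric \<Rightarrow> real \<Rightarrow> (real \<Rightarrow> 'a) \<Rightarrow> 'a \<Rightarrow> 'a \<Rightarrow> bool" where
  "geodesic_from_to X l c x y \<longleftrightarrow>
     0 \<le> l \<and> continuous_map (top_of_set {0..l}) (mtopology_of X) c \<and> c 0 = x \<and> c l = y \<and>
     (\<forall>s t. 0 \<le> s \<and> s \<le> t \<and> t \<le> l \<longrightarrow> curve_length X c s t = ennreal (t - s)) \<and>
     curve_length X c 0 l = ennreal (mdist X x y)"

definition geodesic_space :: "'a metric \<Rightarrow> bool" where
  "geodesic_space X \<longleftrightarrow>
     (\<forall>x\<in>mspace X. \<forall>y\<in>mspace X. \<exists>l c. geodesic_from_to X l c x y)"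

section \<open>Covering maps between abstract topological spaces\<close>

text \<open>The analogue of \<^const>\<open>covering_space\<close>, which is only available for type-class topologies.\<close>

definition covering_map :: "'a topology \<Rightarrow> 'b topology \<Rightarrow> ('a \<Rightarrow> 'b) \<Rightarrow> bool" where
  "covering_map C S p \<longleftrightarrow>
     continuous_map C S p \<and> p ` topspace C = topspace S \<and>
     (\<forall>x\<in>topspace S. \<exists>T. x \<in> T \<and> openin S T \<and>
        (\<exists>v. \<Union>v = {y \<in> topspace C. p y \<in> T} \<and> (\<forall>u\<in>v. openin C u) \<and> pairwise disjnt v \<and>
             (\<forall>u\<in>v. homeomorphic_map (subtopology C u) (subtopology S T) p)))"

definition deck_transformation :: "'a topology \<Rightarrow> ('a \<Rightarrow> 'b) \<Rightarrow> ('a \<Rightarrow> 'a) \<Rightarrow> bool" where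
  "deck_transformation C p h \<longleftrightarrow> homeomorphic_map C C h \<and> (\<forall>y\<in>topspace C. p (h y) = p y)"

definition regular_covering_map :: "'a topology \<Rightarrow> 'b topology \<Rightarrow> ('a \<Rightarrow> 'b) \<Rightarrow> bool" where
  "regular_covering_map C S p \<longleftrightarrow> covering_map C S p \<and>
     (\<forall>y\<in>topspace C. \<forall>z\<in>topspace C. p y = p z \<longrightarrow> (\<exists>h. deck_transformation C p h \<and> h y = z))"

text \<open>The paths \<open>c\<close> range over the paths of \<open>Y\<close> in its own metric topology. Since the infimum
  over the empty set is \<open>\<infinity>\<close>, the condition makes \<open>Y\<close> path connected.\<close>

definition lifted_geodesic_metric :: "'b metric \<Rightarrow> 'a metric \<Rightarrow> ('b \<Rightarrow> 'a) \<Rightarrow> bool" where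
  "lifted_geodesic_metric Y X f \<longleftrightarrow>
     (\<forall>x\<in>mspace Y. \<forall>y\<in>mspace Y.
        ennreal (mdist Y x y) =
          (INF c \<in> {c. pathin (mtopology_of Y) c \<and> c 0 = x \<and> c 1 = y}.
             curve_length X (f \<circ> c) 0 1))"

text \<open>Lifts of paths are unique, so the existence of a lift that is a loop at the base point
  \<open>y0\<close> says that the lift starting at \<open>y0\<close> is a loop.\<close>

definition lifts_as_loop :: "'b metric \<Rightarrow> 'b \<Rightarrow> ('b \<Rightarrow> 'a) \<Rightarrow> (real \<Rightarrow> 'a) \<Rightarrow> bool" where
  "lifts_as_loop Y y0 f c \<longleftrightarrow>
     (\<exists>c'. pathin (mtopology_of Y) c' \<and> c' 0 = y0 \<and> c' 1 = y0 \<and> (\<forall>t\<in>{0..1}. f (c' t) = c t))"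

section \<open>\<open>\<epsilon>\<close>-chains and \<open>\<epsilon>\<close>-homotopy\<close>

definition eps_chain :: "'a metric \<Rightarrow> real \<Rightarrow> 'a list \<Rightarrow> bool" where
  "eps_chain X \<epsilon> xs \<longleftrightarrow>
     xs \<noteq> [] \<and> set xs \<subseteq> mspace X \<and> successively (\<lambda>x y. mdist X x y < \<epsilon>) xs"

definition insert_point :: "'a list \<Rightarrow> 'a list \<Rightarrow> bool" where
  "insert_point xs ys \<longleftrightarrow> (\<exists>us p vs. xs = us @ vs \<and> ys = us @ p # vs)"

text \<open>The endpoints are fixed as points, not as positions: \<open>[x]\<close> and \<open>[x, x]\<close> differ by
  one step.\<close>

definition eps_step :: "'a metric \<Rightarrow> real \<Rightarrow> 'a list \<Rightarrow> 'a list \<Rightarrow> bool" where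
  "eps_step X \<epsilon> xs ys \<longleftrightarrow>
     eps_chain X \<epsilon> xs \<and> eps_chain X \<epsilon> ys \<and> hd xs = hd ys \<and> last xs = last ys \<and>
     (insert_point xs ys \<or> insert_point ys xs)"

definition eps_class :: "'a metric \<Rightarrow> real \<Rightarrow> 'a list \<Rightarrow> 'a list set" where
  "eps_class X \<epsilon> xs = {ys. (eps_step X \<epsilon>)\<^sup>*\<^sup>* xs ys}"

definition chain_concat :: "'a list \<Rightarrow> 'a list \<Rightarrow> 'a list" where
  "chain_concat xs ys = xs @ tl ys"

text \<open>In the next two definitions, all representatives give the same class, so the union is the
  class of the concatenation and the infimum is over one class.\<close>

definition eps_mult :: "'a metric \<Rightarrow> real \<Rightarrow> 'a list set \<Rightarrow> 'a list set \<Rightarrow> 'a list set" where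
  "eps_mult X \<epsilon> A B = (\<Union>\<alpha>\<in>A. \<Union>\<beta>\<in>B. eps_class X \<epsilon> (chain_concat \<alpha> \<beta>))"

definition eps_points :: "'a metric \<Rightarrow> 'a \<Rightarrow> real \<Rightarrow> 'a list set set" where
  "eps_points X x0 \<epsilon> = {eps_class X \<epsilon> \<alpha> | \<alpha>. eps_chain X \<epsilon> \<alpha> \<and> hd \<alpha> = x0}"

definition eps_dist :: "'a metric \<Rightarrow> 'a \<Rightarrow> real \<Rightarrow> 'a list set \<Rightarrow> 'a list set \<Rightarrow> real" where
  "eps_dist X x0 \<epsilon> A B =
     (if A \<in> eps_points X x0 \<epsilon> \<and> B \<in> eps_points X x0 \<epsilon>
      then INF \<gamma> \<in> (\<Union>\<alpha>\<in>A. \<Union>\<beta>\<in>B. eps_class X \<epsilon> (chain_concat (rev \<alpha>) \<beta>)). chain_length X \<gamma>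
      else 0)"

definition eps_space :: "'a metric \<Rightarrow> 'a \<Rightarrow> real \<Rightarrow> 'a list set metric" where
  "eps_space X x0 \<epsilon> = metric (eps_points X x0 \<epsilon>, eps_dist X x0 \<epsilon>)"

definition eps_endpoint :: "'a list set \<Rightarrow> 'a" where
  "eps_endpoint A = (THE x. \<forall>\<alpha>\<in>A. last \<alpha> = x)"

definition eps_group :: "'a metric \<Rightarrow> 'a \<Rightarrow> real \<Rightarrow> 'a list set monoid" where
  "eps_group X x0 \<epsilon> =
     \<lparr>carrier = {eps_class X \<epsilon> \<alpha> | \<alpha>. eps_chain X \<epsilon> \<alpha> \<and> hd \<alpha> = x0 \<and> last \<alpha> = x0},
      monoid.mult = eps_mult X \<epsilon>, one = eps_class X \<epsilon> [x0]\<rparr>"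

text \<open>A stringing is parameterized over \<open>[0, 1]\<close>, with an arbitrary subdivision
  \<open>0 = t\<^sub>0 < \<dots> < t\<^sub>n = 1\<close> separating the concatenated paths. The one-point chain, where
  nothing is concatenated, has the constant path as its stringing.\<close>

definition stringing :: "'a metric \<Rightarrow> real \<Rightarrow> 'a list \<Rightarrow> (real \<Rightarrow> 'a) \<Rightarrow> bool" where
  "stringing X \<epsilon> xs c \<longleftrightarrow>
     pathin (mtopology_of X) c \<and>
     (let n = length xs - 1 in
      if n = 0 then \<forall>t\<in>{0..1}. c t = hd xs
      else \<exists>t. t 0 = 0 \<and> t n = 1 \<and> (\<forall>i\<le>n. c (t i) = xs ! i) \<and>
               (\<forall>i<n. t i < t (Suc i) \<and> c ` {t i..t (Suc i)} \<subseteq> mball_of X (xs ! i) \<epsilon>))"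

section \<open>Orbit spaces\<close>

definition quotient_topology :: "'a topology \<Rightarrow> ('a \<Rightarrow> 'b) \<Rightarrow> 'b topology" where
  "quotient_topology T q =
     topology (\<lambda>U. U \<subseteq> q ` topspace T \<and> openin T {x \<in> topspace T. q x \<in> U})"

definition eps_orbit :: "'a metric \<Rightarrow> real \<Rightarrow> 'a list set set \<Rightarrow> 'a list set \<Rightarrow> 'a list set set" where
  "eps_orbit X \<epsilon> K A = (\<lambda>B. eps_mult X \<epsilon> B A) ` K"

definition eps_orbit_topology ::
  "'a metric \<Rightarrow> 'a \<Rightarrow> real \<Rightarrow> 'a list set set \<Rightarrow> 'a list set set topology" where
  "eps_orbit_topology X x0 \<epsilon> K =
     quotient_topology (mtopology_of (eps_space X x0 \<epsilon>)) (eps_orbit X \<epsilon> K)"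

definition orbit_endpoint :: "'a list set set \<Rightarrow> 'a" where
  "orbit_endpoint P = (THE x. \<forall>A\<in>P. eps_endpoint A = x)"

definition covering_equivalence ::
  "'b topology \<Rightarrow> ('b \<Rightarrow> 'a) \<Rightarrow> 'c topology \<Rightarrow> ('c \<Rightarrow> 'a) \<Rightarrow> ('b \<Rightarrow> 'c) \<Rightarrow> bool" where
  "covering_equivalence S f T \<xi> \<phi> \<longleftrightarrow>
     homeomorphic_map S T \<phi> \<and> (\<forall>y\<in>topspace S. \<xi> (\<phi> y) = f y)"

section \<open>Well-definedness\<close>

text \<open>\<^const>\<open>topology\<close> and \<^const>\<open>metric\<close> are meaningful only on arguments that satisfy the
  respective axioms; \<^const>\<open>eps_mult\<close> and \<^const>\<open>eps_endpoint\<close> must not depend on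
  representatives.\<close>

lemma openin_quotient_topology:
  "openin (quotient_topology T q) U \<longleftrightarrow>
     U \<subseteq> q ` topspace T \<and> openin T {x \<in> topspace T. q x \<in> U}"
proof -
  have "istopology (\<lambda>U. U \<subseteq> q ` topspace T \<and> openin T {x \<in> topspace T. q x \<in> U})"
    unfolding istopology_def
  proof (intro conjI allI impI)
    fix S S' assume "S \<subseteq> q ` topspace T \<and> openin T {x \<in> topspace T. q x \<in> S}"
      "S' \<subseteq> q ` topspace T \<and> openin T {x \<in> topspace T. q x \<in> S'}"
    moreover have "{x \<in> topspace T. q x \<in> S \<inter> S'} =
        {x \<in> topspace T. q x \<in> S} \<inter> {x \<in> topspace T. q x \<in> S'}" by auto
    ultimately show "S \<inter> S' \<subseteq> q ` topspace T" "openin T {x \<in> topspace T. q x \<in> S \<inter> S'}"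
      by auto
  next
    fix F assume F: "\<forall>S\<in>F. S \<subseteq> q ` topspace T \<and> openin T {x \<in> topspace T. q x \<in> S}"
    then show "\<Union>F \<subseteq> q ` topspace T" by auto
    have "{x \<in> topspace T. q x \<in> \<Union>F} = (\<Union>S\<in>F. {x \<in> topspace T. q x \<in> S})" by auto
    then show "openin T {x \<in> topspace T. q x \<in> \<Union>F}" using F by auto
  qed
  then show ?thesis
    unfolding quotient_topology_def by (simp add: topology_inverse')
qed

lemma topspace_quotient_topology: "topspace (quotient_topology T q) = q ` topspace T"
proof
  show "topspace (quotient_topology T q) \<subseteq> q ` topspace T"
    using openin_quotient_topology openin_topspace by metis
  have "{x \<in> topspace T. q x \<in> q ` topspace T} = topspace T" by auto
  then have "openin (quotient_topology T q) (q ` topspace T)"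
    by (simp add: openin_quotient_topology)
  then show "q ` topspace T \<subseteq> topspace (quotient_topology T q)"
    by (rule openin_subset)
qed

lemma quotient_map_quotient_topology: "quotient_map T (quotient_topology T q) q"
  by (auto simp: quotient_map_def topspace_quotient_topology openin_quotient_topology)

lemma mdist_self: "x \<in> mspace X \<Longrightarrow> mdist X x x = 0"
  by simp

lemma UN2_const:
  assumes "x \<in> A" "y \<in> B" "\<And>a b. a \<in> A \<Longrightarrow> b \<in> B \<Longrightarrow> h a b = C"
  shows "(\<Union>a\<in>A. \<Union>b\<in>B. h a b) = C"
proof
  show "(\<Union>a\<in>A. \<Union>b\<in>B. h a b) \<subseteq> C" by (intro UN_least) (simp add: assms(3))
  show "C \<subseteq> (\<Union>a\<in>A. \<Union>b\<in>B. h a b)" using assms(1,2) assms(3)[OF assms(1,2)] by blast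
qed

lemma eps_step_sym: "eps_step X \<epsilon> xs ys \<Longrightarrow> eps_step X \<epsilon> ys xs"
  by (auto simp: eps_step_def)

lemma eps_hom_sym: "(eps_step X \<epsilon>)\<^sup>*\<^sup>* xs ys \<Longrightarrow> (eps_step X \<epsilon>)\<^sup>*\<^sup>* ys xs"
  by (rule sympD[OF symp_rtranclp]) (auto intro: sympI eps_step_sym)

lemma eps_hom_chain:
  assumes "(eps_step X \<epsilon>)\<^sup>*\<^sup>* xs ys" "eps_chain X \<epsilon> xs"
  shows "eps_chain X \<epsilon> ys \<and> hd ys = hd xs \<and> last ys = last xs"
  using assms by (induction rule: rtranclp_induct) (auto simp: eps_step_def)

lemma eps_class_eq:
  "(eps_step X \<epsilon>)\<^sup>*\<^sup>* xs ys \<Longrightarrow> eps_class X \<epsilon> xs = eps_class X \<epsilon> ys"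
  unfolding eps_class_def using eps_hom_sym[of X \<epsilon> xs ys]
  by (intro Collect_cong iffI) (blast intro: rtranclp_trans)+

lemma eps_chain_ne: "eps_chain X \<epsilon> xs \<Longrightarrow> xs \<noteq> []"
  by (simp add: eps_chain_def)

lemma eps_chain_rev: "eps_chain X \<epsilon> xs \<Longrightarrow> eps_chain X \<epsilon> (rev xs)"
  by (simp add: eps_chain_def mdist_commute)

lemma eps_chain_concat:
  assumes "eps_chain X \<epsilon> xs" "eps_chain X \<epsilon> ys" "last xs = hd ys"
  shows "eps_chain X \<epsilon> (chain_concat xs ys)"
  using assms
  by (cases ys) (auto simp: eps_chain_def chain_concat_def successively_append_iff successively_Cons)

lemma hd_chain_concat: "xs \<noteq> [] \<Longrightarrow> hd (chain_concat xs ys) = hd xs"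
  by (simp add: chain_concat_def)

lemma last_chain_concat: "ys \<noteq> [] \<Longrightarrow> last xs = hd ys \<Longrightarrow> last (chain_concat xs ys) = last ys"
  by (cases ys) (auto simp: chain_concat_def)

lemma chain_concat_assoc:
  "ys \<noteq> [] \<Longrightarrow> chain_concat (chain_concat xs ys) zs = chain_concat xs (chain_concat ys zs)"
  by (simp add: chain_concat_def)

lemma chain_concat_rev:
  assumes "xs \<noteq> []" "ys \<noteq> []" "last xs = hd ys"
  shows "rev (chain_concat xs ys) = chain_concat (rev ys) (rev xs)"
  using assms by (cases ys; cases xs rule: rev_cases) (auto simp: chain_concat_def)

lemma insert_point_append1: "insert_point xs ys \<Longrightarrow> insert_point (xs @ zs) (ys @ zs)"
  unfolding insert_point_def by (metis append.assoc append_Cons)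

lemma insert_point_rev:
  assumes "insert_point xs ys"
  shows "insert_point (rev xs) (rev ys)"
proof -
  obtain us p vs where "xs = us @ vs" "ys = us @ p # vs"
    using assms by (auto simp: insert_point_def)
  then have "rev xs = rev vs @ rev us" "rev ys = rev vs @ p # rev us" by auto
  then show ?thesis unfolding insert_point_def by blast
qed

lemma eps_step_concat1:
  assumes "eps_step X \<epsilon> xs xs'" "eps_chain X \<epsilon> ys" "last xs = hd ys"
  shows "eps_step X \<epsilon> (chain_concat xs ys) (chain_concat xs' ys)"
proof -
  have "last xs' = hd ys" "eps_chain X \<epsilon> xs" "eps_chain X \<epsilon> xs'" "hd xs = hd xs'"
    using assms by (auto simp: eps_step_def)
  moreover have "insert_point (chain_concat xs ys) (chain_concat xs' ys) \<or>
      insert_point (chain_concat xs' ys) (chain_concat xs ys)"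
    using assms(1) insert_point_append1 by (auto simp: eps_step_def chain_concat_def)
  ultimately show ?thesis
    using assms by (simp add: eps_step_def eps_chain_concat hd_chain_concat last_chain_concat eps_chain_ne)
qed

lemma eps_step_rev: "eps_step X \<epsilon> xs ys \<Longrightarrow> eps_step X \<epsilon> (rev xs) (rev ys)"
  using insert_point_rev
  by (auto simp: eps_step_def eps_chain_rev hd_rev last_rev eps_chain_ne)

lemma eps_hom_rev: "(eps_step X \<epsilon>)\<^sup>*\<^sup>* xs ys \<Longrightarrow> (eps_step X \<epsilon>)\<^sup>*\<^sup>* (rev xs) (rev ys)"
  by (induction rule: rtranclp_induct) (auto intro: rtranclp.rtrancl_into_rtrancl eps_step_rev)

lemma eps_hom_concat1:
  assumes "(eps_step X \<epsilon>)\<^sup>*\<^sup>* xs xs'" "eps_chain X \<epsilon> xs" "eps_chain X \<epsilon> ys" "last xs = hd ys"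
  shows "(eps_step X \<epsilon>)\<^sup>*\<^sup>* (chain_concat xs ys) (chain_concat xs' ys)"
  using assms
proof (induction rule: rtranclp_induct)
  case (step y z)
  then have "last y = hd ys" using eps_hom_chain by metis
  then show ?case using step eps_step_concat1 by (metis rtranclp.rtrancl_into_rtrancl)
qed simp

lemma eps_hom_concat:
  assumes "(eps_step X \<epsilon>)\<^sup>*\<^sup>* xs xs'" "(eps_step X \<epsilon>)\<^sup>*\<^sup>* ys ys'"
    "eps_chain X \<epsilon> xs" "eps_chain X \<epsilon> ys" "last xs = hd ys"
  shows "(eps_step X \<epsilon>)\<^sup>*\<^sup>* (chain_concat xs ys) (chain_concat xs' ys')"
proof -
  have 1: "(eps_step X \<epsilon>)\<^sup>*\<^sup>* (chain_concat xs ys) (chain_concat xs' ys)"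
    using assms eps_hom_concat1 by metis
  have c: "eps_chain X \<epsilon> xs'" "last xs' = hd ys" "eps_chain X \<epsilon> ys'" "hd ys' = hd ys"
    using assms eps_hom_chain by metis+
  then have "(eps_step X \<epsilon>)\<^sup>*\<^sup>* (chain_concat (rev ys) (rev xs')) (chain_concat (rev ys') (rev xs'))"
    using assms
    by (intro eps_hom_concat1 eps_hom_rev eps_chain_rev)
       (auto simp: hd_rev last_rev eps_chain_ne)
  from eps_hom_rev[OF this]
  have "(eps_step X \<epsilon>)\<^sup>*\<^sup>* (chain_concat xs' ys) (chain_concat xs' ys')"
    using c assms eps_chain_ne[of X \<epsilon> xs'] eps_chain_ne[of X \<epsilon> ys] eps_chain_ne[of X \<epsilon> ys']
    by (simp add: chain_concat_rev hd_rev last_rev)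
  with 1 show ?thesis by (rule rtranclp_trans)
qed

lemma eps_hom_rev_self:
  assumes "eps_chain X \<epsilon> xs" "\<epsilon> > 0"
  shows "(eps_step X \<epsilon>)\<^sup>*\<^sup>* (chain_concat (rev xs) xs) [last xs]"
  using assms
proof (induction xs)
  case (Cons x xs)
  show ?case
  proof (cases xs)
    case Nil
    then show ?thesis by (simp add: chain_concat_def)
  next
    case (Cons y ys)
    have xs: "eps_chain X \<epsilon> xs" "mdist X x y < \<epsilon>" "x \<in> mspace X" "y \<in> mspace X"
      using Cons.prems Cons by (auto simp: eps_chain_def)
    have yy: "mdist X y y < \<epsilon>" using xs assms(2) by (simp add: mdist_self)
    have ch: "eps_chain X \<epsilon> (rev xs @ xs)"
      using xs yy Cons Cons.prems eps_chain_rev[OF xs(1)]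
      by (auto simp: eps_chain_def successively_append_iff successively_Cons mdist_commute)
    have big: "eps_chain X \<epsilon> (chain_concat (rev (x # xs)) (x # xs))"
      using eps_chain_concat[OF eps_chain_rev[OF Cons.prems(1)] Cons.prems(1)] by simp
    have small: "eps_chain X \<epsilon> (chain_concat (rev xs) xs)"
      using xs(1) Cons by (intro eps_chain_concat eps_chain_rev) auto
    have "insert_point (rev xs @ xs) (chain_concat (rev (x # xs)) (x # xs))"
      unfolding insert_point_def chain_concat_def by (intro exI[of _ "rev xs"] exI[of _ x] exI[of _ xs]) auto
    then have 1: "eps_step X \<epsilon> (chain_concat (rev (x # xs)) (x # xs)) (rev xs @ xs)"
      using big ch Cons by (auto simp: eps_step_def chain_concat_def hd_append)
    have "insert_point (chain_concat (rev xs) xs) (rev xs @ xs)"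
      unfolding insert_point_def chain_concat_def Cons
      by (intro exI[of _ "rev (y # ys)"] exI[of _ y] exI[of _ ys]) auto
    then have 2: "eps_step X \<epsilon> (rev xs @ xs) (chain_concat (rev xs) xs)"
      using ch small Cons by (auto simp: eps_step_def chain_concat_def hd_append)
    have "(eps_step X \<epsilon>)\<^sup>*\<^sup>* (chain_concat (rev (x # xs)) (x # xs)) [last xs]"
      using 1 2 Cons.IH[OF xs(1) assms(2)] by (meson converse_rtranclp_into_rtranclp)
    then show ?thesis using Cons by simp
  qed
qed (simp add: eps_chain_def)

lemma chain_length_simps [simp]:
  "chain_length X [] = 0" "chain_length X [x] = 0"
  "chain_length X (x # y # zs) = mdist X x y + chain_length X (y # zs)"
  by (simp_all add: chain_length_def)

lemma chain_length_Cons: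
  "chain_length X (x # xs) = (if xs = [] then 0 else mdist X x (hd xs) + chain_length X xs)"
  by (cases xs) auto

lemma chain_length_nonneg: "0 \<le> chain_length X xs"
  by (induction xs) (auto simp: chain_length_Cons)

lemma chain_length_append:
  "chain_length X (xs @ y # ys) = chain_length X (xs @ [y]) + chain_length X (y # ys)"
  by (induction xs) (auto simp: chain_length_Cons hd_append)

lemma chain_length_concat:
  assumes "xs \<noteq> []" "ys \<noteq> []" "last xs = hd ys"
  shows "chain_length X (chain_concat xs ys) = chain_length X xs + chain_length X ys"
  using assms chain_length_append[of X "butlast xs" "hd ys" "tl ys"]
  by (cases ys; cases xs rule: rev_cases) (auto simp: chain_concat_def)

lemma chain_length_rev: "chain_length X (rev xs) = chain_length X xs"
proof (induction xs)
  case (Cons x xs)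
  show ?case
  proof (cases xs)
    case (Cons y ys)
    then show ?thesis
      using Cons.IH chain_length_append[of X "rev ys" y "[x]"] by (simp add: mdist_commute)
  qed simp
qed simp

lemma mdist_le_chain_length:
  assumes "set xs \<subseteq> mspace X" "xs \<noteq> []"
  shows "mdist X (hd xs) (last xs) \<le> chain_length X xs"
  using assms
proof (induction xs)
  case (Cons x xs)
  show ?case
  proof (cases xs)
    case Nil
    then show ?thesis using Cons.prems by (simp add: mdist_self)
  next
    case (Cons y ys)
    have "mdist X x (last xs) \<le> mdist X x y + mdist X y (last xs)"
      using Cons.prems Cons by (intro mdist_triangle) auto
    also have "mdist X y (last xs) \<le> chain_length X xs"
      using Cons.IH Cons.prems Cons by auto
    finally show ?thesis using Cons by auto
  qed
qed simp

lemma eps_hom_short: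
  assumes "eps_chain X \<epsilon> xs" "chain_length X xs < \<epsilon>" "hd xs = last xs"
  shows "(eps_step X \<epsilon>)\<^sup>*\<^sup>* xs [hd xs]"
  using assms
proof (induction "length xs" arbitrary: xs rule: less_induct)
  case less
  consider x where "xs = [x]" | x y where "xs = [x, y]" | x y z zs where "xs = x # y # z # zs"
    using eps_chain_ne[OF less.prems(1)] by (metis neq_Nil_conv)
  then show ?case
  proof cases
    case 2
    then have "eps_step X \<epsilon> xs [hd xs]"
      using less.prems
      by (auto simp: eps_step_def insert_point_def eps_chain_def intro!: exI[of _ "[]"])
    then show ?thesis by auto
  next
    case 3
    have mem: "x \<in> mspace X" "y \<in> mspace X" "z \<in> mspace X"
      using less.prems 3 by (auto simp: eps_chain_def)
    have tri: "mdist X x z \<le> mdist X x y + mdist X y z" using mem by (intro mdist_triangle)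
    have len: "chain_length X (x # z # zs) \<le> chain_length X xs" using tri 3 by simp
    have "mdist X x z < \<epsilon>"
      using tri less.prems(2) 3 chain_length_nonneg[of X "z # zs"] by simp
    then have ch: "eps_chain X \<epsilon> (x # z # zs)"
      using less.prems 3 by (auto simp: eps_chain_def)
    have "insert_point (x # z # zs) xs"
      unfolding insert_point_def 3
      by (intro exI[of _ "[x]"] exI[of _ y] exI[of _ "z # zs"]) auto
    then have st: "eps_step X \<epsilon> xs (x # z # zs)"
      using ch less.prems 3 by (auto simp: eps_step_def)
    have "(eps_step X \<epsilon>)\<^sup>*\<^sup>* (x # z # zs) [hd (x # z # zs)]"
      using ch len less.prems 3 by (intro less.hyps) auto
    then show ?thesis using st 3 by (auto intro: converse_rtranclp_into_rtranclp)
  qed auto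
qed

lemma eps_class_self: "xs \<in> eps_class X \<epsilon> xs"
  by (simp add: eps_class_def)

lemma in_eps_classD:
  assumes "ys \<in> eps_class X \<epsilon> xs" "eps_chain X \<epsilon> xs"
  shows "(eps_step X \<epsilon>)\<^sup>*\<^sup>* xs ys" "eps_chain X \<epsilon> ys" "hd ys = hd xs" "last ys = last xs"
  using assms eps_hom_chain by (auto simp: eps_class_def)

lemma eps_mult_class:
  assumes "eps_chain X \<epsilon> xs" "eps_chain X \<epsilon> ys" "last xs = hd ys"
  shows "eps_mult X \<epsilon> (eps_class X \<epsilon> xs) (eps_class X \<epsilon> ys) = eps_class X \<epsilon> (chain_concat xs ys)"
proof -
  have "eps_class X \<epsilon> (chain_concat xs' ys') = eps_class X \<epsilon> (chain_concat xs ys)"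
    if "xs' \<in> eps_class X \<epsilon> xs" "ys' \<in> eps_class X \<epsilon> ys" for xs' ys'
    using eps_hom_concat[of X \<epsilon> xs xs' ys ys'] that assms
    by (intro eps_class_eq[symmetric]) (auto simp: eps_class_def)
  then show ?thesis
    unfolding eps_mult_def by (intro UN2_const[OF eps_class_self eps_class_self])
qed

lemma eps_endpoint_class:
  assumes "eps_chain X \<epsilon> xs"
  shows "eps_endpoint (eps_class X \<epsilon> xs) = last xs"
  unfolding eps_endpoint_def
  using assms eps_class_self[of xs] by (intro the_equality) (auto dest: in_eps_classD)

lemma eps_dist_class:
  assumes "eps_chain X \<epsilon> xs" "eps_chain X \<epsilon> ys" "hd xs = x0" "hd ys = x0"
  shows "eps_dist X x0 \<epsilon> (eps_class X \<epsilon> xs) (eps_class X \<epsilon> ys) =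
    (INF \<gamma> \<in> eps_class X \<epsilon> (chain_concat (rev xs) ys). chain_length X \<gamma>)"
proof -
  have eq: "eps_class X \<epsilon> (chain_concat (rev xs') ys') = eps_class X \<epsilon> (chain_concat (rev xs) ys)"
    if "xs' \<in> eps_class X \<epsilon> xs" "ys' \<in> eps_class X \<epsilon> ys" for xs' ys'
    using eps_hom_concat[of X \<epsilon> "rev xs" "rev xs'" ys ys'] that assms
    by (intro eps_class_eq[symmetric])
       (auto simp: eps_class_def last_rev eps_chain_rev eps_chain_ne eps_hom_rev)
  have "(\<Union>xs'\<in>eps_class X \<epsilon> xs. \<Union>ys'\<in>eps_class X \<epsilon> ys. eps_class X \<epsilon> (chain_concat (rev xs') ys'))
      = eps_class X \<epsilon> (chain_concat (rev xs) ys)"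
    by (intro UN2_const[OF eps_class_self eps_class_self] eq)
  then show ?thesis
    using assms unfolding eps_dist_def eps_points_def by auto
qed

lemma Metric_space_eps:
  assumes "\<epsilon> > 0"
  shows "Metric_space (eps_points X x0 \<epsilon>) (eps_dist X x0 \<epsilon>)"
proof -
  let ?C = "eps_class X \<epsilon>" and ?P = "eps_points X x0 \<epsilon>" and ?d = "eps_dist X x0 \<epsilon>"
  let ?ch = "\<lambda>xs. eps_chain X \<epsilon> xs \<and> hd xs = x0"
  have P: "\<exists>xs. A = ?C xs \<and> ?ch xs" if "A \<in> ?P" for A
    using that by (auto simp: eps_points_def)
  have bdd: "bdd_below (chain_length X ` S)" for S
    by (rule bdd_belowI2[of _ 0]) (rule chain_length_nonneg)
  have cc: "eps_chain X \<epsilon> (chain_concat (rev xs) ys) \<and>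
      hd (chain_concat (rev xs) ys) = last xs \<and> last (chain_concat (rev xs) ys) = last ys"
    if "?ch xs" "?ch ys" for xs ys
    using that eps_chain_ne[of X \<epsilon> xs] eps_chain_ne[of X \<epsilon> ys]
    by (simp add: eps_chain_concat eps_chain_rev last_rev hd_chain_concat hd_rev last_chain_concat)
  have dle: "?d (?C xs) (?C ys) \<le> chain_length X g"
    if "?ch xs" "?ch ys" "g \<in> ?C (chain_concat (rev xs) ys)" for xs ys g
    using that by (simp add: eps_dist_class) (intro cINF_lower bdd)
  have dless: "\<exists>g \<in> ?C (chain_concat (rev xs) ys). chain_length X g < r"
    if "?ch xs" "?ch ys" "?d (?C xs) (?C ys) < r" for xs ys r
  proof -
    have "?C (chain_concat (rev xs) ys) \<noteq> {}" using eps_class_self by blast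
    then show ?thesis using that by (simp add: eps_dist_class cINF_less_iff[OF _ bdd])
  qed
  have nonneg: "0 \<le> ?d A B" for A B
  proof (cases "A \<in> ?P \<and> B \<in> ?P")
    case True
    then obtain xs ys where "A = ?C xs" "?ch xs" "B = ?C ys" "?ch ys" using P by meson
    then show ?thesis
      using eps_class_self chain_length_nonneg
      by (simp add: eps_dist_class) (intro cINF_greatest; blast)
  next
    case False
    then show ?thesis unfolding eps_dist_def by (simp only: if_not_P if_False)
  qed
  have sym_le: "?d (?C xs) (?C ys) \<le> ?d (?C ys) (?C xs)" if c: "?ch xs" "?ch ys" for xs ys
  proof (rule field_le_epsilon)
    fix e :: real assume "e > 0"
    then obtain g where g: "g \<in> ?C (chain_concat (rev ys) xs)"
      "chain_length X g < ?d (?C ys) (?C xs) + e"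
      using dless[OF c(2,1)] by (metis less_add_same_cancel1)
    have "(eps_step X \<epsilon>)\<^sup>*\<^sup>* (rev (chain_concat (rev ys) xs)) (rev g)"
      using g(1) by (intro eps_hom_rev) (simp add: eps_class_def)
    moreover have "rev (chain_concat (rev ys) xs) = chain_concat (rev xs) ys"
      using c eps_chain_ne[of X \<epsilon> xs] eps_chain_ne[of X \<epsilon> ys] by (simp add: chain_concat_rev last_rev)
    ultimately have "rev g \<in> ?C (chain_concat (rev xs) ys)" by (simp add: eps_class_def)
    from dle[OF c this] show "?d (?C xs) (?C ys) \<le> ?d (?C ys) (?C xs) + e"
      using g(2) by (simp add: chain_length_rev)
  qed
  have sym: "?d A B = ?d B A" for A B
  proof (cases "A \<in> ?P \<and> B \<in> ?P")
    case True
    then obtain xs ys where "A = ?C xs" "?ch xs" "B = ?C ys" "?ch ys" using P by meson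
    then show ?thesis using sym_le by (intro antisym) auto
  next
    case False
    then show ?thesis unfolding eps_dist_def by auto
  qed
  have refl: "?d (?C xs) (?C xs) = 0" if c: "?ch xs" for xs
  proof -
    have "[last xs] \<in> ?C (chain_concat (rev xs) xs)"
      using eps_hom_rev_self[OF conjunct1[OF c] assms] by (simp add: eps_class_def)
    from dle[OF c c this] show ?thesis using nonneg by (metis antisym chain_length_simps(2))
  qed
  have cancel: "(eps_step X \<epsilon>)\<^sup>*\<^sup>* (chain_concat (chain_concat xs (rev xs)) ys) ys"
    if "eps_chain X \<epsilon> xs" "eps_chain X \<epsilon> ys" "hd xs = hd ys" for xs ys
  proof -
    have "(eps_step X \<epsilon>)\<^sup>*\<^sup>* (chain_concat (rev (rev xs)) (rev xs)) [last (rev xs)]"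
      using that assms by (intro eps_hom_rev_self eps_chain_rev)
    then have 1: "(eps_step X \<epsilon>)\<^sup>*\<^sup>* (chain_concat xs (rev xs)) [hd ys]"
      using that eps_chain_ne[of X \<epsilon> xs] by (simp add: last_rev)
    have "(eps_step X \<epsilon>)\<^sup>*\<^sup>* (chain_concat (chain_concat xs (rev xs)) ys) (chain_concat [hd ys] ys)"
      using that 1 eps_chain_ne[of X \<epsilon> xs]
      by (intro eps_hom_concat1 eps_chain_concat eps_chain_rev) (auto simp: hd_rev last_rev last_chain_concat)
    moreover have "chain_concat [hd ys] ys = ys"
      using that eps_chain_ne[of X \<epsilon> ys] by (simp add: chain_concat_def)
    ultimately show ?thesis by simp
  qed
  have zero: "?C xs = ?C ys" if c: "?ch xs" "?ch ys" and z: "?d (?C xs) (?C ys) = 0" for xs ys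
  proof -
    have ne: "xs \<noteq> []" "ys \<noteq> []" using c eps_chain_ne by auto
    have mem: "last xs \<in> mspace X" "last ys \<in> mspace X"
      using c last_in_set[OF ne(1)] last_in_set[OF ne(2)] by (auto simp: eps_chain_def)
    have dl: "mdist X (last xs) (last ys) \<le> chain_length X g"
      if "g \<in> ?C (chain_concat (rev xs) ys)" for g
    proof -
      have "eps_chain X \<epsilon> g" "hd g = last xs" "last g = last ys"
        using in_eps_classD[OF that] cc[OF c] by auto
      then show ?thesis using mdist_le_chain_length[of g X] by (auto simp: eps_chain_def)
    qed
    have "mdist X (last xs) (last ys) \<le> ?d (?C xs) (?C ys)"
    proof (rule ccontr)
      assume "\<not> ?thesis"
      then obtain g where "g \<in> ?C (chain_concat (rev xs) ys)"
        "chain_length X g < mdist X (last xs) (last ys)"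
        using dless[OF c, of "mdist X (last xs) (last ys)"] by force
      with dl show False by force
    qed
    then have le: "last xs = last ys" using z mem by (metis antisym mdist_nonneg mdist_zero)
    obtain g where g: "g \<in> ?C (chain_concat (rev xs) ys)" "chain_length X g < \<epsilon>"
      using dless[OF c, of \<epsilon>] z assms by auto
    have gc: "eps_chain X \<epsilon> g" "hd g = last xs" "last g = last xs"
      using in_eps_classD[OF g(1)] cc[OF c] le by auto
    have "(eps_step X \<epsilon>)\<^sup>*\<^sup>* (chain_concat (rev xs) ys) [last xs]"
      using eps_hom_short[OF gc(1) g(2)] gc g(1) by (auto simp: eps_class_def)
    then have "(eps_step X \<epsilon>)\<^sup>*\<^sup>* (chain_concat xs (chain_concat (rev xs) ys)) (chain_concat xs [last xs])"
      using c cc[OF c] by (intro eps_hom_concat) auto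
    then have "(eps_step X \<epsilon>)\<^sup>*\<^sup>* (chain_concat (chain_concat xs (rev xs)) ys) xs"
      using ne by (simp add: chain_concat_assoc) (simp add: chain_concat_def)
    moreover have "(eps_step X \<epsilon>)\<^sup>*\<^sup>* (chain_concat (chain_concat xs (rev xs)) ys) ys"
      using c by (intro cancel) auto
    ultimately show ?thesis using eps_class_eq by metis
  qed
  have tri: "?d (?C xs) (?C zs) \<le> ?d (?C xs) (?C ys) + ?d (?C ys) (?C zs)"
    if c: "?ch xs" "?ch ys" "?ch zs" for xs ys zs
  proof (rule field_le_epsilon)
    fix e :: real assume e: "e > 0"
    obtain g where g: "g \<in> ?C (chain_concat (rev xs) ys)"
      "chain_length X g < ?d (?C xs) (?C ys) + e / 2"
      using dless[OF c(1,2), of "?d (?C xs) (?C ys) + e / 2"] e by auto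
    obtain h where h: "h \<in> ?C (chain_concat (rev ys) zs)"
      "chain_length X h < ?d (?C ys) (?C zs) + e / 2"
      using dless[OF c(2,3), of "?d (?C ys) (?C zs) + e / 2"] e by auto
    have ne: "xs \<noteq> []" "ys \<noteq> []" "zs \<noteq> []" using c eps_chain_ne by auto
    have gc: "eps_chain X \<epsilon> g" "last g = last ys" and hc: "eps_chain X \<epsilon> h" "hd h = last ys"
      using in_eps_classD[OF g(1)] in_eps_classD[OF h(1)] cc[OF c(1,2)] cc[OF c(2,3)] by auto
    have 1: "(eps_step X \<epsilon>)\<^sup>*\<^sup>* (chain_concat (chain_concat (rev xs) ys) (chain_concat (rev ys) zs))
        (chain_concat g h)"
      using g h cc[OF c(1,2)] cc[OF c(2,3)] by (intro eps_hom_concat) (auto simp: eps_class_def)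
    have eq: "chain_concat (chain_concat (rev xs) ys) (chain_concat (rev ys) zs) =
        chain_concat (rev xs) (chain_concat (chain_concat ys (rev ys)) zs)"
      using ne by (simp add: chain_concat_assoc)
    have can: "(eps_step X \<epsilon>)\<^sup>*\<^sup>* zs (chain_concat (chain_concat ys (rev ys)) zs)"
      using c by (intro eps_hom_sym[OF cancel]) auto
    have "(eps_step X \<epsilon>)\<^sup>*\<^sup>* (chain_concat (rev xs) zs)
        (chain_concat (rev xs) (chain_concat (chain_concat ys (rev ys)) zs))"
      using c can ne by (intro eps_hom_concat eps_chain_rev) (auto simp: last_rev)
    then have "chain_concat g h \<in> ?C (chain_concat (rev xs) zs)"
      using 1 eq unfolding eps_class_def by (simp add: rtranclp_trans)
    from dle[OF c(1,3) this]
    have "?d (?C xs) (?C zs) \<le> chain_length X g + chain_length X h"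
      using chain_length_concat[of g h X] gc hc eps_chain_ne[of X \<epsilon> g] eps_chain_ne[of X \<epsilon> h] by simp
    then show "?d (?C xs) (?C zs) \<le> ?d (?C xs) (?C ys) + ?d (?C ys) (?C zs) + e"
      using g(2) h(2) by simp
  qed
  show ?thesis
  proof
    show "?d A B = 0 \<longleftrightarrow> A = B" if "A \<in> ?P" "B \<in> ?P" for A B
      using P[OF that(1)] P[OF that(2)] zero refl by metis
    show "?d A D \<le> ?d A B + ?d B D" if "A \<in> ?P" "B \<in> ?P" "D \<in> ?P" for A B D
      using P[OF that(1)] P[OF that(2)] P[OF that(3)] tri by metis
  qed (rule nonneg, rule sym)
qed

lemma mspace_eps_space: "\<epsilon> > 0 \<Longrightarrow> mspace (eps_space X x0 \<epsilon>) = eps_points X x0 \<epsilon>"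
  and mdist_eps_space: "\<epsilon> > 0 \<Longrightarrow> mdist (eps_space X x0 \<epsilon>) = eps_dist X x0 \<epsilon>"
  by (simp_all add: eps_space_def Metric_space_eps Metric_space.mspace_metric
      Metric_space.mdist_metric)

lemma group_eps_group:
  assumes "\<epsilon> > 0" "x0 \<in> mspace X"
  shows "group (eps_group X x0 \<epsilon>)"
proof -
  let ?C = "eps_class X \<epsilon>" and ?G = "eps_group X x0 \<epsilon>"
  let ?l = "\<lambda>xs. eps_chain X \<epsilon> xs \<and> hd xs = x0 \<and> last xs = x0"
  have car: "A \<in> carrier ?G \<longleftrightarrow> (\<exists>xs. A = ?C xs \<and> ?l xs)" for A
    by (auto simp: eps_group_def)
  have mul: "?C xs \<otimes>\<^bsub>?G\<^esub> ?C ys = ?C (chain_concat xs ys)" if "?l xs" "?l ys" for xs ys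
    using that by (simp add: eps_group_def eps_mult_class)
  have lc: "?l (chain_concat xs ys)" if "?l xs" "?l ys" for xs ys
    using that eps_chain_ne[of X \<epsilon> xs] eps_chain_ne[of X \<epsilon> ys]
    by (simp add: eps_chain_concat hd_chain_concat last_chain_concat)
  have l1: "?l [x0]" using assms(2) by (simp add: eps_chain_def)
  have one: "\<one>\<^bsub>?G\<^esub> = ?C [x0]" by (simp add: eps_group_def)
  have inv: "?l (rev xs) \<and> ?C (chain_concat (rev xs) xs) = ?C [x0]" if "?l xs" for xs
    using that eps_class_eq[OF eps_hom_rev_self[of X \<epsilon> xs]] assms(1) eps_chain_ne[of X \<epsilon> xs]
    by (simp add: eps_chain_rev hd_rev last_rev)
  show ?thesis
  proof (rule groupI)
    show "A \<otimes>\<^bsub>?G\<^esub> B \<in> carrier ?G" if "A \<in> carrier ?G" "B \<in> carrier ?G" for A B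
      using that mul lc unfolding car by metis
    show "\<one>\<^bsub>?G\<^esub> \<in> carrier ?G" using one l1 unfolding car by metis
  next
    fix A B D assume "A \<in> carrier ?G" "B \<in> carrier ?G" "D \<in> carrier ?G"
    then obtain xs ys zs where "A = ?C xs" "?l xs" "B = ?C ys" "?l ys" "D = ?C zs" "?l zs"
      unfolding car by metis
    then show "A \<otimes>\<^bsub>?G\<^esub> B \<otimes>\<^bsub>?G\<^esub> D = A \<otimes>\<^bsub>?G\<^esub> (B \<otimes>\<^bsub>?G\<^esub> D)"
      using chain_concat_assoc[of ys xs zs] eps_chain_ne[of X \<epsilon> ys] by (simp add: mul lc)
  next
    fix A assume "A \<in> carrier ?G"
    then obtain xs where xs: "A = ?C xs" "?l xs" unfolding car by metis
    have "chain_concat [x0] xs = xs"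
      using xs(2) eps_chain_ne[of X \<epsilon> xs] by (auto simp: chain_concat_def)
    then show "\<one>\<^bsub>?G\<^esub> \<otimes>\<^bsub>?G\<^esub> A = A" using mul[OF l1 xs(2)] one xs(1) by simp
    show "\<exists>B\<in>carrier ?G. B \<otimes>\<^bsub>?G\<^esub> A = \<one>\<^bsub>?G\<^esub>"
    proof (rule bexI)
      show "?C (rev xs) \<otimes>\<^bsub>?G\<^esub> A = \<one>\<^bsub>?G\<^esub>"
        using inv[OF xs(2)] mul[of "rev xs" xs] one xs by simp
      show "?C (rev xs) \<in> carrier ?G" using inv[OF xs(2)] unfolding car by blast
    qed
  qed
qed

end

theory Submission
  imports Defs
begin

text \<open>A stringing of an \<open>\<epsilon>\<close>-chain \<open>\<kappa>\<close> from the base point lifts to a path in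
  \<open>X\<^sub>\<epsilon>\<close> that ends at \<open>[\<kappa>]\<close>, so composing with \<open>g\<close> and using uniqueness of path lifting
  in \<open>Y\<close>, it lifts as a loop iff \<open>g [\<kappa>]\<close> is the base point of \<open>Y\<close>. Since this depends on the
  class only, \<open>K\<close> is the set of group elements that \<open>g\<close> sends to the base point. A group element
  \<open>D\<close> acts on the connected space \<open>X\<^sub>\<epsilon>\<close> by an isometry over \<open>X\<close>, and \<open>g\<close> and \<open>g \<circ> D\<close> lift the
  same map; hence they coincide as soon as they agree at one point, which happens exactly for
  \<open>D \<in> K\<close>. So the fibres of \<open>g\<close> are the \<open>K\<close>-orbits. The deck transformations of \<open>f\<close> are the maps to
  which elements \<open>D\<close> descend along \<open>g\<close>, and all \<open>D\<close> descend iff \<open>K\<close> is normal.\<close>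

section \<open>Covering maps\<close>

lemma covering_mapE:
  assumes "covering_map C S p" "x \<in> topspace S"
  obtains T v where "x \<in> T" "openin S T" "\<Union>v = {y \<in> topspace C. p y \<in> T}"
    "\<And>u. u \<in> v \<Longrightarrow> openin C u" "pairwise disjnt v"
    "\<And>u. u \<in> v \<Longrightarrow> homeomorphic_map (subtopology C u) (subtopology S T) p"
proof -
  have "\<exists>T. x \<in> T \<and> openin S T \<and> (\<exists>v. \<Union>v = {y \<in> topspace C. p y \<in> T} \<and>
      (\<forall>u\<in>v. openin C u) \<and> pairwise disjnt v \<and>
      (\<forall>u\<in>v. homeomorphic_map (subtopology C u) (subtopology S T) p))"
    using assms by (simp add: covering_map_def)
  then show thesis by (elim exE conjE, intro that) (assumption | erule bspec)+
qed

text \<open>Openness is checked point by point: inside the sheet \<open>u\<close> through a point of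
  \<open>U\<close>, \<open>p\<close> is a homeomorphism onto an open \<open>T\<close>, so
  \<open>p\<close> maps \<open>U \<inter> u\<close> to an open set.\<close>

lemma covering_map_open_map:
  assumes "covering_map C S p"
  shows "open_map C S p"
  unfolding open_map_def
proof (intro allI impI)
  fix U assume U: "openin C U"
  show "openin S (p ` U)"
  proof (subst openin_subopen, intro ballI)
    fix x assume "x \<in> p ` U"
    then obtain y where y: "y \<in> U" "x = p y" by auto
    have yC: "y \<in> topspace C" using y(1) U openin_subset by blast
    then have "x \<in> topspace S" using assms y(2) by (auto simp: covering_map_def)
    then obtain T v where T: "x \<in> T" "openin S T" "\<Union>v = {y \<in> topspace C. p y \<in> T}"
      and v: "\<And>u. u \<in> v \<Longrightarrow> homeomorphic_map (subtopology C u) (subtopology S T) p"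
      by (rule covering_mapE[OF assms]) blast
    have "y \<in> \<Union>v" using T yC y(2) by auto
    then obtain u where u: "u \<in> v" "y \<in> u" by auto
    have "openin (subtopology C u) (U \<inter> u)" using U by (simp add: openin_subtopology_Int)
    then have "openin (subtopology S T) (p ` (U \<inter> u))"
      using v[OF u(1)] homeomorphic_imp_open_map unfolding open_map_def by blast
    then have "openin S (p ` (U \<inter> u))" using T(2) openin_trans_full by blast
    then show "\<exists>V. openin S V \<and> x \<in> V \<and> V \<subseteq> p ` U" using y u by blast
  qed
qed

lemma covering_map_quotient_map: "covering_map C S p \<Longrightarrow> quotient_map C S p"
  by (intro continuous_open_imp_quotient_map covering_map_open_map)
     (simp_all add: covering_map_def)

text \<open>The set where two lifts agree is clopen. The domain \<open>Z\<close> is kept general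
  because it will be the unit interval (lifts of stringings) and also the whole space of chain
  classes (comparing \<open>g\<close> with its translates).\<close>

lemma covering_map_lift_unique:
  assumes p: "covering_map C S p" and Z: "connected_space Z"
    and hk: "continuous_map Z C h" "continuous_map Z C k"
    and eq: "\<And>z. z \<in> topspace Z \<Longrightarrow> p (h z) = p (k z)"
    and z0: "z0 \<in> topspace Z" "h z0 = k z0" and z: "z \<in> topspace Z"
  shows "h z = k z"
proof -
  have loc: "\<exists>W. openin Z W \<and> z \<in> W \<and> W \<subseteq> {w \<in> topspace Z. (h w = k w) = (h z = k z)}"
    if z: "z \<in> topspace Z" for z
  proof -
    have hz: "h z \<in> topspace C" "k z \<in> topspace C"
      using hk z by (auto simp: continuous_map_def)
    then have "p (h z) \<in> topspace S" using p by (auto simp: covering_map_def)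
    then obtain T v where T: "p (h z) \<in> T" "openin S T" "\<Union>v = {y \<in> topspace C. p y \<in> T}"
      and v: "\<And>u. u \<in> v \<Longrightarrow> openin C u" "pairwise disjnt v"
        "\<And>u. u \<in> v \<Longrightarrow> homeomorphic_map (subtopology C u) (subtopology S T) p"
      by (rule covering_mapE[OF p]) blast
    have "h z \<in> \<Union>v" "k z \<in> \<Union>v" using T hz eq[OF z] by auto
    then obtain u u' where u: "u \<in> v" "h z \<in> u" and u': "u' \<in> v" "k z \<in> u'" by auto
    \<comment> \<open>On \<open>W\<close> each map stays in one sheet, \<open>h\<close> in
      \<open>u\<close> and \<open>k\<close> in \<open>u'\<close>. Distinct sheets are disjoint and
      \<open>p\<close> is injective on each, so throughout \<open>W\<close> agreement means exactly
      \<open>u = u'\<close>.\<close>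
    define W where "W = {w \<in> topspace Z. h w \<in> u} \<inter> {w \<in> topspace Z. k w \<in> u'}"
    have "openin Z W" unfolding W_def
      using hk v(1) u(1) u'(1) by (intro openin_Int openin_continuous_map_preimage) auto
    moreover have "z \<in> W" using z u u' by (simp add: W_def)
    moreover have "(h w = k w) = (u = u')" if "w \<in> W" for w
    proof
      assume "h w = k w"
      then have "\<not> disjnt u u'" using that by (auto simp: W_def disjnt_iff)
      then show "u = u'" using v(2) u u' by (meson pairwiseD)
    next
      assume "u = u'"
      moreover have "inj_on p u"
        using homeomorphic_imp_injective_map[OF v(3)[OF u(1)]] openin_subset[OF v(1)[OF u(1)]]
        by (simp add: Int_absorb1)
      ultimately show "h w = k w" using that eq[of w] by (auto simp: W_def dest: inj_onD)
    qed
    ultimately show ?thesis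
      using openin_subset by (intro exI[of _ W] conjI subsetI CollectI) (blast, blast, blast, metis)
  qed
  let ?E = "{z \<in> topspace Z. h z = k z}"
  \<comment> \<open>The two values of \<open>b\<close> give the agreement set and its
    complement.\<close>
  have openI: "openin Z {z \<in> topspace Z. (h z = k z) = b}" for b
  proof (subst openin_subopen, intro ballI)
    fix z assume "z \<in> {z \<in> topspace Z. (h z = k z) = b}"
    then have "z \<in> topspace Z" "(h z = k z) = b" by auto
    then show "\<exists>W. openin Z W \<and> z \<in> W \<and> W \<subseteq> {z \<in> topspace Z. (h z = k z) = b}"
      using loc[of z] by simp
  qed
  have "openin Z ?E" using openI[of True] by simp
  moreover have "topspace Z - ?E = {z \<in> topspace Z. (h z = k z) = False}" by auto
  then have "openin Z (topspace Z - ?E)" using openI[of False] by simp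
  then have "closedin Z ?E" by (auto simp: closedin_def)
  ultimately have "?E = {} \<or> ?E = topspace Z" using Z connected_space_clopen_in by blast
  then show ?thesis using z0 z by auto
qed

section \<open>Stringings\<close>

text \<open>The pasting lemma, iterated over the \<open>n + 1\<close> segments with indices
  \<open>0\<close> to \<open>n\<close>. It assembles geodesics into a stringing and, later, local
  lifts into a lift of a stringing.\<close>

lemma continuous_map_segments:
  fixes t :: "nat \<Rightarrow> real" and \<gamma> :: "nat \<Rightarrow> real \<Rightarrow> 'a"
  assumes "\<And>i. i \<le> n \<Longrightarrow> t i \<le> t (Suc i)"
    and "\<And>i. i \<le> n \<Longrightarrow> continuous_map (top_of_set {t i..t (Suc i)}) S (\<gamma> i)"
    and "\<And>i. i < n \<Longrightarrow> \<gamma> i (t (Suc i)) = \<gamma> (Suc i) (t (Suc i))"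
  shows "\<exists>h. continuous_map (top_of_set {t 0..t (Suc n)}) S h \<and>
             (\<forall>i\<le>n. \<forall>s\<in>{t i..t (Suc i)}. h s = \<gamma> i s)"
  using assms
proof (induction n)
  case 0
  then show ?case by (intro exI[of _ "\<gamma> 0"]) auto
next
  case (Suc n)
  obtain h where h: "continuous_map (top_of_set {t 0..t (Suc n)}) S h"
    "\<And>i s. i \<le> n \<Longrightarrow> s \<in> {t i..t (Suc i)} \<Longrightarrow> h s = \<gamma> i s"
    using Suc.IH Suc.prems by (metis le_SucI less_SucI)
  have mono: "t i \<le> t j" if "i \<le> j" "j \<le> Suc (Suc n)" for i j
    using that
  proof (induction rule: dec_induct)
    case (step k)
    then show ?case using Suc.prems(1)[of k] by auto
  qed simp
  let ?I = "{t 0..t (Suc (Suc n))}"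
  let ?k = "\<lambda>s. if s \<le> t (Suc n) then h s else \<gamma> (Suc n) s"
  have "continuous_map (top_of_set ?I) S ?k"
  proof (rule continuous_map_cases_le)
    have "?I \<inter> {s \<in> topspace (top_of_set ?I). s \<le> t (Suc n)} = {t 0..t (Suc n)}"
      using mono[of "Suc n" "Suc (Suc n)"] by auto
    moreover have "?I \<inter> {s \<in> topspace (top_of_set ?I). t (Suc n) \<le> s} = {t (Suc n)..t (Suc (Suc n))}"
      using mono[of 0 "Suc n"] by auto
    ultimately show
      "continuous_map (subtopology (top_of_set ?I) {s \<in> topspace (top_of_set ?I). s \<le> t (Suc n)}) S h"
      "continuous_map (subtopology (top_of_set ?I) {s \<in> topspace (top_of_set ?I). t (Suc n) \<le> s})
         S (\<gamma> (Suc n))"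
      using h(1) Suc.prems(2)[of "Suc n"] by (simp_all only: subtopology_subtopology)
    show "h s = \<gamma> (Suc n) s" if "s \<in> topspace (top_of_set ?I)" "s = t (Suc n)" for s
      using h(2)[of n s] Suc.prems(3)[of n] Suc.prems(1)[of n] that by auto
  qed (auto intro: continuous_map_from_subtopology)
  moreover have "?k s = \<gamma> i s" if i: "i \<le> Suc n" and s: "s \<in> {t i..t (Suc i)}" for i s
  proof (cases "i \<le> n")
    case True
    then show ?thesis using h(2)[OF True s] mono[of "Suc i" "Suc n"] s by auto
  next
    case False
    then have [simp]: "i = Suc n" using i by simp
    have "h (t (Suc n)) = \<gamma> (Suc n) (t (Suc n))"
      using h(2)[of n "t (Suc n)"] Suc.prems(3)[of n] Suc.prems(1)[of n] by auto
    moreover have "s = t (Suc n)" if "s \<le> t (Suc n)" using s that by auto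
    ultimately show ?thesis by auto
  qed
  ultimately show ?case by (intro exI[of _ ?k]) blast
qed

text \<open>Arclength parameterization bounds the distance from \<open>x\<close> to
  \<open>c s\<close> by \<open>s\<close>, hence by the total length, which is the distance from
  \<open>x\<close> to \<open>y\<close>.\<close>

lemma geodesic_path_in_ball:
  assumes X: "geodesic_space X" and x: "x \<in> mspace X" "y \<in> mspace X" "mdist X x y < \<epsilon>"
  shows "\<exists>c. pathin (mtopology_of X) c \<and> c 0 = x \<and> c 1 = y \<and> c ` {0..1} \<subseteq> mball_of X x \<epsilon>"
proof -
  obtain l c where "geodesic_from_to X l c x y"
    using assms unfolding geodesic_space_def by metis
  then have l: "0 \<le> l" and c: "continuous_map (top_of_set {0..l}) (mtopology_of X) c"
    "c 0 = x" "c l = y"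
    and len: "\<And>s. 0 \<le> s \<Longrightarrow> s \<le> l \<Longrightarrow> curve_length X c 0 s = ennreal s"
      "curve_length X c 0 l = ennreal (mdist X x y)"
    by (auto simp: geodesic_from_to_def)
  have "l = mdist X x y" using l len(1)[of l] len(2) by simp
  have mem: "c s \<in> mspace X" if "s \<in> {0..l}" for s
    using c(1) that by (auto simp: continuous_map_def)
  have ball: "c s \<in> mball_of X x \<epsilon>" if s: "s \<in> {0..l}" for s
  proof -
    \<comment> \<open>The two-point subdivision \<open>[0, s]\<close> is one competitor in the
      supremum defining the curve length.\<close>
    have "ennreal (chain_length X (map c [0, s])) \<le> curve_length X c 0 s"
      unfolding curve_length_def using s by (intro SUP_upper) auto
    then have "mdist X x (c s) \<le> s" using s len(1)[of s] c(2) by simp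
    then show ?thesis
      using s x mem \<open>l = mdist X x y\<close> by (auto simp: mball_of_def Metric_space.in_mball)
  qed
  have "continuous_map (top_of_set {0..1}) (top_of_set {0..l}) (\<lambda>s. l * s)"
    using l by (auto simp: continuous_map_in_subtopology mult_left_le intro!: continuous_intros)
  then have "pathin (mtopology_of X) (c \<circ> (\<lambda>s. l * s))"
    unfolding pathin_def using c(1) by (rule continuous_map_compose)
  moreover have "(c \<circ> (\<lambda>s. l * s)) ` {0..1} \<subseteq> mball_of X x \<epsilon>"
    using l by (auto intro!: ball simp: mult_left_le)
  ultimately show ?thesis using c by (intro exI[of _ "c \<circ> (\<lambda>s. l * s)"]) auto
qed

lemma eps_chain_nth_less:
  "eps_chain X \<epsilon> xs \<Longrightarrow> Suc i < length xs \<Longrightarrow> mdist X (xs ! i) (xs ! Suc i) < \<epsilon>"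
  by (simp add: eps_chain_def successively_conv_nth)

text \<open>Consecutive points are less than \<epsilon> apart, so geodesics between them stay in the
  required balls; they are run one after another at equal time intervals.\<close>

lemma stringing_exists:
  assumes X: "geodesic_space X" and xs: "eps_chain X \<epsilon> xs"
  shows "\<exists>c. stringing X \<epsilon> xs c"
proof (cases "length xs - 1")
  case 0
  have "hd xs \<in> mspace X" using xs by (auto simp: eps_chain_def)
  then have "pathin (mtopology_of X) (\<lambda>_. hd xs)" by (simp add: pathin_const)
  then show ?thesis using 0 by (intro exI[of _ "\<lambda>_. hd xs"]) (simp add: stringing_def)
next
  case (Suc n)
  then have len: "length xs = Suc (Suc n)" by simp
  have mem: "xs ! i \<in> mspace X" if "i \<le> Suc n" for i
    using xs len that nth_mem[of i xs] by (auto simp: eps_chain_def)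
  have "\<exists>c. pathin (mtopology_of X) c \<and> c 0 = xs ! i \<and> c 1 = xs ! Suc i \<and>
      c ` {0..1} \<subseteq> mball_of X (xs ! i) \<epsilon>" if "i \<le> n" for i
    using that len mem eps_chain_nth_less[OF xs] by (intro geodesic_path_in_ball[OF X]) auto
  then obtain p where p: "\<And>i. i \<le> n \<Longrightarrow> pathin (mtopology_of X) (p i) \<and> p i 0 = xs ! i \<and>
      p i 1 = xs ! Suc i \<and> p i ` {0..1} \<subseteq> mball_of X (xs ! i) \<epsilon>" by metis
  define t where "t = (\<lambda>i. real i / real (Suc n))"
  define \<gamma> where "\<gamma> = (\<lambda>i s. p i (real (Suc n) * s - real i))"
  \<comment> \<open>The affine change of parameter takes the \<open>i\<close>-th segment onto the
    unit interval. The equivalence serves twice: for continuity of \<open>\<gamma> i\<close> and for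
    its staying in the ball.\<close>
  have aff: "real (Suc n) * s - real i \<in> {0..1} \<longleftrightarrow> s \<in> {t i..t (Suc i)}" for i s
    by (auto simp: t_def field_simps)
  have tt: "\<gamma> i (t i) = p i 0" "\<gamma> i (t (Suc i)) = p i 1" for i
    by (simp_all add: \<gamma>_def t_def)
  have "continuous_map (top_of_set {t i..t (Suc i)}) (mtopology_of X) (\<gamma> i)" if "i \<le> n" for i
  proof -
    have "continuous_map (top_of_set {t i..t (Suc i)}) (top_of_set {0..1})
        (\<lambda>s. real (Suc n) * s - real i)"
      using aff[of _ i] by (auto simp: continuous_map_in_subtopology simp del: of_nat_Suc
          intro!: continuous_intros)
    then have "continuous_map (top_of_set {t i..t (Suc i)}) (mtopology_of X)
        (p i \<circ> (\<lambda>s. real (Suc n) * s - real i))"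
      using p[OF that] unfolding pathin_def by (intro continuous_map_compose) auto
    then show ?thesis by (simp add: \<gamma>_def o_def)
  qed
  moreover have "t i < t (Suc i)" for i by (simp add: t_def divide_strict_right_mono)
  moreover have "\<gamma> i (t (Suc i)) = \<gamma> (Suc i) (t (Suc i))" if "i < n" for i
    using that p[of i] p[of "Suc i"] by (simp add: tt)
  ultimately obtain h where h: "continuous_map (top_of_set {t 0..t (Suc n)}) (mtopology_of X) h"
      "\<And>i s. i \<le> n \<Longrightarrow> s \<in> {t i..t (Suc i)} \<Longrightarrow> h s = \<gamma> i s"
    using continuous_map_segments[of n t "mtopology_of X" \<gamma>] by (metis less_imp_le)
  have t01: "t 0 = 0" "t (Suc n) = 1" by (simp_all add: t_def)
  have "h (t i) = xs ! i" if "i \<le> Suc n" for i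
  proof (cases i)
    case 0
    then show ?thesis using h(2)[of 0 "t 0"] p[of 0] \<open>t 0 < t (Suc 0)\<close> by (simp add: tt)
  next
    case (Suc j)
    then show ?thesis using h(2)[of j "t (Suc j)"] p[of j] \<open>t j < t (Suc j)\<close> that by (simp add: tt)
  qed
  moreover have "h ` {t i..t (Suc i)} \<subseteq> mball_of X (xs ! i) \<epsilon>" if "i \<le> n" for i
  proof -
    have "\<gamma> i s \<in> mball_of X (xs ! i) \<epsilon>" if "s \<in> {t i..t (Suc i)}" for s
      using p[OF \<open>i \<le> n\<close>] that unfolding \<gamma>_def aff[symmetric] by blast
    then show ?thesis using h(2)[OF that] by auto
  qed
  ultimately show ?thesis
    using h(1) t01 Suc \<open>\<And>i. t i < t (Suc i)\<close>
    unfolding stringing_def pathin_def by (intro exI[of _ h]) (auto simp: Let_def less_Suc_eq_le intro!: exI[of _ t])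
qed

section \<open>The space of \<open>\<epsilon>\<close>-chain classes\<close>

lemma continuous_map_to_mtopology_of:
  assumes "\<And>z. z \<in> topspace Z \<Longrightarrow> h z \<in> mspace M"
    and "\<And>z r. z \<in> topspace Z \<Longrightarrow> r > 0 \<Longrightarrow>
      \<exists>U. openin Z U \<and> z \<in> U \<and> (\<forall>w\<in>U. mdist M (h z) (h w) < r)"
  shows "continuous_map Z (mtopology_of M) h"
proof -
  have "continuous_map Z (Metric_space.mtopology (mspace M) (mdist M)) h"
    unfolding Metric_space.continuous_map_to_metric[OF Metric_space_mspace_mdist]
  proof (intro ballI allI impI)
    fix z and r :: real assume z: "z \<in> topspace Z" "0 < r"
    then obtain U where "openin Z U" "z \<in> U" "\<forall>w\<in>U. mdist M (h z) (h w) < r"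
      using assms(2) by metis
    then show "\<exists>U. openin Z U \<and> z \<in> U \<and>
        (\<forall>w\<in>U. h w \<in> Metric_space.mball (mspace M) (mdist M) (h z) r)"
      using assms(1) z openin_subset[of Z U]
      by (intro exI[of _ U]) (auto simp: Metric_space.in_mball[OF Metric_space_mspace_mdist])
  qed
  then show ?thesis by (simp add: mtopology_of_def)
qed

lemma eps_chain_snoc:
  assumes "eps_chain X \<epsilon> \<alpha>" "y \<in> mspace X" "mdist X (last \<alpha>) y < \<epsilon>"
  shows "eps_chain X \<epsilon> (\<alpha> @ [y])"
  using assms by (auto simp: eps_chain_def successively_append_iff)

text \<open>Repeating the last point is a single insertion, legal because a point has distance 0 <
  \<epsilon> to itself.\<close>

lemma eps_class_snoc_last:
  assumes "eps_chain X \<epsilon> \<alpha>" "\<epsilon> > 0"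
  shows "eps_class X \<epsilon> (\<alpha> @ [last \<alpha>]) = eps_class X \<epsilon> \<alpha>"
proof -
  have ne: "\<alpha> \<noteq> []" using assms(1) by (rule eps_chain_ne)
  have "last \<alpha> \<in> mspace X" using assms(1) last_in_set[OF ne] by (auto simp: eps_chain_def)
  then have "eps_chain X \<epsilon> (\<alpha> @ [last \<alpha>])"
    using assms by (intro eps_chain_snoc) (simp_all add: mdist_self)
  moreover have "insert_point \<alpha> (\<alpha> @ [last \<alpha>])"
    unfolding insert_point_def by (intro exI[of _ \<alpha>] exI[of _ "last \<alpha>"] exI[of _ "[]"]) simp
  ultimately have "eps_step X \<epsilon> \<alpha> (\<alpha> @ [last \<alpha>])"
    using assms ne by (auto simp: eps_step_def)
  then show ?thesis using eps_class_eq by (metis r_into_rtranclp)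
qed

locale pointed_scale =
  fixes X :: "'a metric" and x0 :: 'a and \<epsilon> :: real
  assumes x0: "x0 \<in> mspace X" and \<epsilon>: "\<epsilon> > 0"
begin

abbreviation "cls \<equiv> eps_class X \<epsilon>"
abbreviation "P \<equiv> eps_points X x0 \<epsilon>"
abbreviation "C \<equiv> mtopology_of (eps_space X x0 \<epsilon>)"
abbreviation "G \<equiv> eps_group X x0 \<epsilon>"
abbreviation "act \<equiv> eps_mult X \<epsilon>"
abbreviation "base \<equiv> cls [x0]"

lemma mspace_C [simp]: "mspace (eps_space X x0 \<epsilon>) = P"
  by (rule mspace_eps_space[OF \<epsilon>])

lemma in_P: "eps_chain X \<epsilon> \<alpha> \<Longrightarrow> hd \<alpha> = x0 \<Longrightarrow> cls \<alpha> \<in> P"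
  by (auto simp: eps_points_def)

lemma P_cases:
  assumes "A \<in> P" obtains \<alpha> where "A = cls \<alpha>" "eps_chain X \<epsilon> \<alpha>" "hd \<alpha> = x0"
  using assms by (auto simp: eps_points_def)

lemma in_G: "eps_chain X \<epsilon> \<alpha> \<Longrightarrow> hd \<alpha> = x0 \<Longrightarrow> last \<alpha> = x0 \<Longrightarrow> cls \<alpha> \<in> carrier G"
  by (auto simp: eps_group_def)

lemma G_cases:
  assumes "A \<in> carrier G"
  obtains \<alpha> where "A = cls \<alpha>" "eps_chain X \<epsilon> \<alpha>" "hd \<alpha> = x0" "last \<alpha> = x0"
  using assms by (auto simp: eps_group_def)

sublocale G: group G
  by (rule group_eps_group[OF \<epsilon> x0])

lemma mult_G: "A \<otimes>\<^bsub>G\<^esub> B = act A B"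
  by (simp add: eps_group_def)

lemma one_G: "\<one>\<^bsub>G\<^esub> = base"
  by (simp add: eps_group_def)

lemma chain_x0: "eps_chain X \<epsilon> [x0]"
  using x0 by (simp add: eps_chain_def)

lemma base_in_P: "base \<in> P"
  by (rule in_P[OF chain_x0]) simp

lemma G_subset_P: "A \<in> carrier G \<Longrightarrow> A \<in> P"
  using G_cases in_P by metis

lemma G_iff: "A \<in> carrier G \<longleftrightarrow> A \<in> P \<and> eps_endpoint A = x0"
  using G_cases P_cases in_P in_G eps_endpoint_class by metis

section \<open>The action of the group of \<epsilon>-loops by preconcatenation\<close>

lemma act_class:
  assumes "eps_chain X \<epsilon> \<beta>" "last \<beta> = x0" "eps_chain X \<epsilon> \<alpha>" "hd \<alpha> = x0"
  shows "act (cls \<beta>) (cls \<alpha>) = cls (chain_concat \<beta> \<alpha>)"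
  using assms by (simp add: eps_mult_class)

lemma act_in_P:
  assumes "D \<in> carrier G" "A \<in> P"
  shows "act D A \<in> P" "eps_endpoint (act D A) = eps_endpoint A"
proof -
  obtain d where d: "D = cls d" "eps_chain X \<epsilon> d" "hd d = x0" "last d = x0"
    using assms(1) by (rule G_cases)
  obtain a where a: "A = cls a" "eps_chain X \<epsilon> a" "hd a = x0"
    using assms(2) by (rule P_cases)
  have c: "eps_chain X \<epsilon> (chain_concat d a)" using d a by (simp add: eps_chain_concat)
  have "act D A = cls (chain_concat d a)" using d a by (simp add: act_class)
  then show "act D A \<in> P" "eps_endpoint (act D A) = eps_endpoint A"
    using c d a in_P[OF c] eps_chain_ne[OF d(2)] eps_chain_ne[OF a(2)]
    by (simp_all add: hd_chain_concat last_chain_concat eps_endpoint_class)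
qed

lemma act_assoc:
  assumes "D \<in> carrier G" "E \<in> carrier G" "A \<in> P"
  shows "act D (act E A) = act (act D E) A"
proof -
  obtain d where d: "D = cls d" "eps_chain X \<epsilon> d" "hd d = x0" "last d = x0"
    using assms(1) by (rule G_cases)
  obtain e where e: "E = cls e" "eps_chain X \<epsilon> e" "hd e = x0" "last e = x0"
    using assms(2) by (rule G_cases)
  obtain a where a: "A = cls a" "eps_chain X \<epsilon> a" "hd a = x0"
    using assms(3) by (rule P_cases)
  have ne: "d \<noteq> []" "e \<noteq> []" "a \<noteq> []" using d e a eps_chain_ne by auto
  show ?thesis
    using d e a ne
    by (simp add: act_class eps_chain_concat hd_chain_concat last_chain_concat chain_concat_assoc)
qed

lemma act_base_left:
  assumes "A \<in> P" shows "act base A = A"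
proof -
  obtain a where a: "A = cls a" "eps_chain X \<epsilon> a" "hd a = x0"
    using assms by (rule P_cases)
  moreover have "chain_concat [x0] a = a"
    using a eps_chain_ne[OF a(2)] by (cases a) (auto simp: chain_concat_def)
  ultimately show ?thesis using chain_x0 by (simp add: act_class)
qed

lemma act_base_right: "D \<in> carrier G \<Longrightarrow> act D base = D"
  using G.r_one[of D] by (simp add: mult_G one_G)

lemma inv_act:
  assumes "D \<in> carrier G" "A \<in> P"
  shows "act (inv\<^bsub>G\<^esub> D) (act D A) = A" "act D (act (inv\<^bsub>G\<^esub> D) A) = A"
  using assms act_assoc[of "inv\<^bsub>G\<^esub> D" D A] act_assoc[of D "inv\<^bsub>G\<^esub> D" A]
    G.l_inv[of D] G.r_inv[of D]
  by (simp_all add: mult_G one_G act_base_left)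

text \<open>The loop running out along \<open>a\<close> and back along \<open>b\<close> does it:
  followed by \<open>b\<close> it becomes \<open>a\<close> and then \<open>rev b\<close>,
  \<open>b\<close>, which contracts to a point.\<close>

lemma act_transitive:
  assumes "A \<in> P" "B \<in> P" "eps_endpoint A = eps_endpoint B"
  shows "\<exists>D\<in>carrier G. act D B = A"
proof -
  obtain a where a: "A = cls a" "eps_chain X \<epsilon> a" "hd a = x0"
    using assms(1) by (rule P_cases)
  obtain b where b: "B = cls b" "eps_chain X \<epsilon> b" "hd b = x0"
    using assms(2) by (rule P_cases)
  have ne: "a \<noteq> []" "b \<noteq> []" using a b eps_chain_ne by auto
  have lst: "last a = last b" using assms(3) a b by (simp add: eps_endpoint_class)
  define d where "d = chain_concat a (rev b)"
  have d: "eps_chain X \<epsilon> d" "hd d = x0" "last d = x0"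
    using a b ne lst
    by (simp_all add: d_def eps_chain_concat eps_chain_rev hd_chain_concat last_chain_concat
        hd_rev last_rev)
  have "(eps_step X \<epsilon>)\<^sup>*\<^sup>* (chain_concat a (chain_concat (rev b) b)) (chain_concat a [last b])"
    using a b ne lst eps_hom_rev_self[OF b(2) \<epsilon>]
    by (intro eps_hom_concat)
       (auto simp: eps_chain_concat eps_chain_rev last_rev hd_chain_concat hd_rev)
  then have "cls (chain_concat d b) = cls a"
    using ne eps_class_eq by (simp add: d_def chain_concat_assoc) (simp add: chain_concat_def)
  then have "act (cls d) B = A" using d a b by (simp add: act_class)
  then show ?thesis using in_G[OF d] by blast
qed

section \<open>Distance estimates and continuity\<close>

lemma eps_dist_le:
  assumes "eps_chain X \<epsilon> \<alpha>" "hd \<alpha> = x0" "eps_chain X \<epsilon> \<beta>" "hd \<beta> = x0"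
    and "\<gamma> \<in> cls (chain_concat (rev \<alpha>) \<beta>)"
  shows "eps_dist X x0 \<epsilon> (cls \<alpha>) (cls \<beta>) \<le> chain_length X \<gamma>"
proof -
  have "bdd_below (chain_length X ` S)" for S
    by (rule bdd_belowI2[of _ 0]) (rule chain_length_nonneg)
  then show ?thesis
    unfolding eps_dist_class[OF assms(1,3,2,4)] using assms(5) by (rule cINF_lower)
qed

text \<open>In \<open>rev (d * a) * (d * b)\<close>, with \<open>*\<close> for concatenation, the
  middle part \<open>rev d * d\<close> contracts. Both distances are therefore infima over the same
  \<epsilon>-homotopy class.\<close>

lemma eps_dist_act:
  assumes "D \<in> carrier G" "A \<in> P" "B \<in> P"
  shows "eps_dist X x0 \<epsilon> (act D A) (act D B) = eps_dist X x0 \<epsilon> A B"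
proof -
  obtain d where d: "D = cls d" "eps_chain X \<epsilon> d" "hd d = x0" "last d = x0"
    using assms(1) by (rule G_cases)
  obtain a where a: "A = cls a" "eps_chain X \<epsilon> a" "hd a = x0"
    using assms(2) by (rule P_cases)
  obtain b where b: "B = cls b" "eps_chain X \<epsilon> b" "hd b = x0"
    using assms(3) by (rule P_cases)
  have ne: "d \<noteq> []" "a \<noteq> []" "b \<noteq> []" using d a b eps_chain_ne by auto
  have da: "eps_chain X \<epsilon> (chain_concat d a)" "eps_chain X \<epsilon> (chain_concat d b)"
    using d a b by (simp_all add: eps_chain_concat)
  have eq: "chain_concat (rev (chain_concat d a)) (chain_concat d b) =
      chain_concat (rev a) (chain_concat (chain_concat (rev d) d) b)"
    using ne d a by (simp add: chain_concat_rev chain_concat_assoc)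
  have "(eps_step X \<epsilon>)\<^sup>*\<^sup>* (chain_concat (chain_concat (rev d) d) b) (chain_concat [x0] b)"
    using d b ne eps_hom_rev_self[OF d(2) \<epsilon>]
    by (intro eps_hom_concat1)
       (auto simp: eps_chain_concat eps_chain_rev last_rev last_chain_concat)
  moreover have "chain_concat (rev d) d \<noteq> []" using ne by (simp add: chain_concat_def)
  moreover have "chain_concat [x0] b = b" using b ne by (cases b) (auto simp: chain_concat_def)
  ultimately have "(eps_step X \<epsilon>)\<^sup>*\<^sup>* (chain_concat (rev (chain_concat d a)) (chain_concat d b))
      (chain_concat (rev a) b)"
    unfolding eq using a b d ne \<open>chain_concat (rev d) d \<noteq> []\<close>
    by (intro eps_hom_concat)
       (auto simp: eps_chain_concat eps_chain_rev last_rev last_chain_concat hd_chain_concat hd_rev)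
  then have "cls (chain_concat (rev (chain_concat d a)) (chain_concat d b)) =
      cls (chain_concat (rev a) b)"
    by (rule eps_class_eq)
  then show ?thesis
    using d a b da ne by (simp add: act_class eps_dist_class hd_chain_concat)
qed

lemma continuous_map_act:
  assumes D: "D \<in> carrier G"
  shows "continuous_map C C (act D)"
proof (rule continuous_map_to_mtopology_of)
  show "act D A \<in> mspace (eps_space X x0 \<epsilon>)" if "A \<in> topspace C" for A
    using that act_in_P(1)[OF D] by simp
next
  fix A and r :: real assume A: "A \<in> topspace C" "0 < r"
  let ?U = "mball_of (eps_space X x0 \<epsilon>) A r"
  have "openin C ?U"
    by (metis Metric_space.openin_mball Metric_space_mspace_mdist mball_of_def mtopology_of_def)
  moreover have "A \<in> ?U" using A by (simp add: mdist_self)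
  moreover have "\<forall>B\<in>?U. mdist (eps_space X x0 \<epsilon>) (act D A) (act D B) < r"
    by (auto simp: mdist_eps_space[OF \<epsilon>] eps_dist_act[OF D])
  ultimately show "\<exists>U. openin C U \<and> A \<in> U \<and>
      (\<forall>B\<in>U. mdist (eps_space X x0 \<epsilon>) (act D A) (act D B) < r)"
    by blast
qed

text \<open>Going back along \<open>\<alpha>\<close> and out again contracts, which leaves the chain
  from \<open>y\<close> through \<open>last \<alpha>\<close> to \<open>z\<close>. As
  \<open>y\<close> and \<open>z\<close> are less than \<epsilon> apart, the middle point can be
  removed, and \<open>[y, z]\<close> competes in the infimum.\<close>

lemma eps_dist_snoc_le:
  assumes \<alpha>: "eps_chain X \<epsilon> \<alpha>" "hd \<alpha> = x0"
    and y: "y \<in> mball_of X (last \<alpha>) \<epsilon>" and z: "z \<in> mball_of X (last \<alpha>) \<epsilon>"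
    and yz: "mdist X y z < \<epsilon>"
  shows "eps_dist X x0 \<epsilon> (cls (\<alpha> @ [y])) (cls (\<alpha> @ [z])) \<le> mdist X y z"
proof -
  let ?x = "last \<alpha>"
  have ne: "\<alpha> \<noteq> []" using \<alpha>(1) by (rule eps_chain_ne)
  have c: "eps_chain X \<epsilon> (\<alpha> @ [y])" "eps_chain X \<epsilon> (\<alpha> @ [z])"
    using \<alpha> y z by (auto intro: eps_chain_snoc)
  have c2: "eps_chain X \<epsilon> [y, ?x]" "eps_chain X \<epsilon> [?x, z]" "eps_chain X \<epsilon> [y, z]"
    "eps_chain X \<epsilon> [y, ?x, z]"
    using y z yz by (auto simp: eps_chain_def mdist_commute)
  have cc: "eps_chain X \<epsilon> (chain_concat (rev \<alpha>) \<alpha>)" "hd (chain_concat (rev \<alpha>) \<alpha>) = ?x"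
      "last (chain_concat (rev \<alpha>) \<alpha>) = ?x"
    using \<alpha> ne by (simp_all add: eps_chain_concat eps_chain_rev hd_chain_concat
        last_chain_concat hd_rev last_rev)
  have "tl (\<alpha> @ [z]) = tl \<alpha> @ [z]" using ne by (simp add: tl_append2)
  \<comment> \<open>Regrouping isolates \<open>chain_concat (rev \<alpha>) \<alpha>\<close>, the
    part that contracts.\<close>
  then have eq: "chain_concat (rev (\<alpha> @ [y])) (\<alpha> @ [z]) =
      chain_concat [y, ?x] (chain_concat (chain_concat (rev \<alpha>) \<alpha>) [?x, z])"
    using ne by (cases \<alpha> rule: rev_cases) (simp_all add: chain_concat_def)
  have inner: "(eps_step X \<epsilon>)\<^sup>*\<^sup>* (chain_concat (chain_concat (rev \<alpha>) \<alpha>) [?x, z])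
      (chain_concat [?x] [?x, z])"
    using eps_hom_rev_self[OF \<alpha>(1) \<epsilon>] cc c2 by (intro eps_hom_concat1) auto
  have "(eps_step X \<epsilon>)\<^sup>*\<^sup>* (chain_concat (rev (\<alpha> @ [y])) (\<alpha> @ [z]))
      (chain_concat [y, ?x] (chain_concat [?x] [?x, z]))"
    unfolding eq using c2 cc eps_chain_ne[OF cc(1)]
    by (intro eps_hom_concat[OF rtranclp.rtrancl_refl inner])
       (auto simp: eps_chain_concat hd_chain_concat)
  also have "chain_concat [y, ?x] (chain_concat [?x] [?x, z]) = [y, ?x, z]"
    by (simp add: chain_concat_def)
  also have "eps_step X \<epsilon> [y, ?x, z] [y, z]"
  proof -
    have "insert_point [y, z] [y, ?x, z]"
      unfolding insert_point_def by (intro exI[of _ "[y]"] exI[of _ ?x] exI[of _ "[z]"]) simp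
    then show ?thesis using c2 by (simp add: eps_step_def)
  qed
  finally have "[y, z] \<in> cls (chain_concat (rev (\<alpha> @ [y])) (\<alpha> @ [z]))"
    by (simp add: eps_class_def)
  from eps_dist_le[OF c(1) _ c(2) _ this] show ?thesis using \<alpha> ne by simp
qed

text \<open>Appending a point is a local section of the endpoint map over the \<epsilon>-ball around
  \<open>last \<alpha>\<close>; this lifts any map \<open>c\<close> into that ball.\<close>

lemma continuous_map_snoc:
  assumes \<alpha>: "eps_chain X \<epsilon> \<alpha>" "hd \<alpha> = x0"
    and c: "continuous_map Z (mtopology_of X) c" "c ` topspace Z \<subseteq> mball_of X (last \<alpha>) \<epsilon>"
  shows "continuous_map Z C (\<lambda>s. cls (\<alpha> @ [c s]))"
proof (rule continuous_map_to_mtopology_of)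
  show "cls (\<alpha> @ [c s]) \<in> mspace (eps_space X x0 \<epsilon>)" if "s \<in> topspace Z" for s
  proof -
    have "c s \<in> mball_of X (last \<alpha>) \<epsilon>" using that c(2) by blast
    then have "eps_chain X \<epsilon> (\<alpha> @ [c s])" using \<alpha>(1) by (intro eps_chain_snoc) auto
    then show ?thesis using \<alpha>(2) eps_chain_ne[OF \<alpha>(1)] by (simp add: in_P)
  qed
next
  fix s and r :: real assume s: "s \<in> topspace Z" "0 < r"
  \<comment> \<open>The radius is capped at \<epsilon> because the distance estimate needs the two
    appended points to be less than \<epsilon> apart.\<close>
  let ?U = "{w \<in> topspace Z. c w \<in> mball_of X (c s) (min r \<epsilon>)}"
  have "openin (mtopology_of X) (mball_of X (c s) (min r \<epsilon>))"
    by (metis Metric_space.openin_mball Metric_space_mspace_mdist mball_of_def mtopology_of_def)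
  then have "openin Z ?U" using c(1) by (rule openin_continuous_map_preimage[rotated])
  moreover have "c s \<in> mspace X" using s c(2) by auto
  then have "s \<in> ?U" using s \<epsilon> by (simp add: mdist_self)
  moreover have "mdist (eps_space X x0 \<epsilon>) (cls (\<alpha> @ [c s])) (cls (\<alpha> @ [c w])) < r" if "w \<in> ?U" for w
  proof -
    have "eps_dist X x0 \<epsilon> (cls (\<alpha> @ [c s])) (cls (\<alpha> @ [c w])) \<le> mdist X (c s) (c w)"
      using that s c(2) by (intro eps_dist_snoc_le[OF \<alpha>]) auto
    then show ?thesis using that by (simp add: mdist_eps_space[OF \<epsilon>])
  qed
  ultimately show "\<exists>U. openin Z U \<and> s \<in> U \<and>
      (\<forall>w\<in>U. mdist (eps_space X x0 \<epsilon>) (cls (\<alpha> @ [c s])) (cls (\<alpha> @ [c w])) < r)"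
    by blast
qed

section \<open>Lifting stringings to the space of chain classes\<close>

lemma eps_chain_take: "eps_chain X \<epsilon> xs \<Longrightarrow> 0 < n \<Longrightarrow> eps_chain X \<epsilon> (take n xs)"
proof -
  assume xs: "eps_chain X \<epsilon> xs" and n: "0 < n"
  then have "successively (\<lambda>x y. mdist X x y < \<epsilon>) (take n xs @ drop n xs)"
    by (simp add: eps_chain_def)
  then show ?thesis
    using xs n set_take_subset[of n xs] unfolding successively_append_iff
    by (auto simp: eps_chain_def)
qed

text \<open>On the \<open>i\<close>-th segment the lift is \<open>[x\<^sub>0, \<dots>, x\<^sub>i, c s]\<close>; at the common end of two
  segments the two descriptions differ by a repeated last point.\<close>

lemma stringing_lift:
  assumes xs: "eps_chain X \<epsilon> xs" "hd xs = x0" and c: "stringing X \<epsilon> xs c"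
  shows "\<exists>h. pathin C h \<and> h 0 = base \<and> h 1 = cls xs \<and> (\<forall>s\<in>{0..1}. eps_endpoint (h s) = c s)"
proof (cases "length xs - 1")
  case 0
  then have "xs = [x0]" using xs eps_chain_ne[OF xs(1)] by (cases xs) auto
  then show ?thesis
    using c base_in_P chain_x0
    by (intro exI[of _ "\<lambda>_. base"]) (auto simp: stringing_def pathin_const eps_endpoint_class)
next
  case (Suc n)
  then have len: "length xs = Suc (Suc n)" by simp
  have cc: "pathin (mtopology_of X) c" using c by (simp add: stringing_def)
  have "\<exists>t. t 0 = 0 \<and> t (Suc n) = 1 \<and> (\<forall>i\<le>Suc n. c (t i) = xs ! i) \<and>
      (\<forall>i<Suc n. t i < t (Suc i) \<and> c ` {t i..t (Suc i)} \<subseteq> mball_of X (xs ! i) \<epsilon>)"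
    using c unfolding stringing_def Suc Let_def by simp
  then obtain t where t: "t 0 = 0" "t (Suc n) = 1"
      "\<And>i. i \<le> Suc n \<Longrightarrow> c (t i) = xs ! i"
      "\<And>i. i \<le> n \<Longrightarrow> t i < t (Suc i) \<and> c ` {t i..t (Suc i)} \<subseteq> mball_of X (xs ! i) \<epsilon>"
    unfolding less_Suc_eq_le by metis
  have mono: "t i \<le> t j" if "i \<le> j" "j \<le> Suc n" for i j
    using that
  proof (induction rule: dec_induct)
    case (step k)
    then show ?case using t(4)[of k] by auto
  qed simp
  let ?\<alpha> = "\<lambda>i. take (Suc i) xs"
  define \<gamma> where "\<gamma> = (\<lambda>i s. cls (?\<alpha> i @ [c s]))"
  have \<alpha>: "eps_chain X \<epsilon> (?\<alpha> i)" "hd (?\<alpha> i) = x0" for i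
    using xs by (simp_all add: eps_chain_take)
  have last_\<alpha>: "last (?\<alpha> i) = xs ! i" if "i \<le> Suc n" for i
    using that len by (simp add: take_Suc_conv_app_nth)
  have cont: "continuous_map (top_of_set {t i..t (Suc i)}) C (\<gamma> i)" if i: "i \<le> n" for i
    unfolding \<gamma>_def
  proof (rule continuous_map_snoc[OF \<alpha>])
    have "{t i..t (Suc i)} \<subseteq> {0..1}"
      using mono[of 0 i] mono[of "Suc i" "Suc n"] i t by auto
    then show "continuous_map (top_of_set {t i..t (Suc i)}) (mtopology_of X) c"
      using cc continuous_map_from_subtopology_mono unfolding pathin_def by blast
    show "c ` topspace (top_of_set {t i..t (Suc i)}) \<subseteq> mball_of X (last (?\<alpha> i)) \<epsilon>"
      using t(4)[OF i] last_\<alpha>[of i] i by auto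
  qed
  have joint: "\<gamma> i (t (Suc i)) = cls (?\<alpha> (Suc i))" if "i \<le> n" for i
    using that len t(3)[of "Suc i"] by (simp add: \<gamma>_def take_Suc_conv_app_nth)
  have "\<gamma> i (t i) = cls (?\<alpha> i)" if "i \<le> n" for i
    using that t(3)[of i] last_\<alpha>[of i] eps_class_snoc_last[OF \<alpha>(1) \<epsilon>, of i]
    by (simp add: \<gamma>_def)
  then obtain h where h: "continuous_map (top_of_set {t 0..t (Suc n)}) C h"
      "\<And>i s. i \<le> n \<Longrightarrow> s \<in> {t i..t (Suc i)} \<Longrightarrow> h s = \<gamma> i s"
    using continuous_map_segments[of n t C \<gamma>] cont t(4) joint
    by (metis Suc_leI le_SucI less_imp_le)
  have "h 0 = \<gamma> 0 (t 0)" using h(2)[of 0 0] t(1) t(4)[of 0] by auto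
  also have "\<dots> = base"
    using \<open>\<And>i. i \<le> n \<Longrightarrow> \<gamma> i (t i) = cls (?\<alpha> i)\<close>[of 0] xs len by (cases xs) auto
  finally have h0: "h 0 = base" .
  have "h 1 = \<gamma> n (t (Suc n))" using h(2)[of n 1] t(2) t(4)[of n] by auto
  \<comment> \<open>The prefix with index \<open>Suc n\<close> is all of \<open>xs\<close>.\<close>
  then have h1: "h 1 = cls xs" using joint[of n] len by simp
  have "eps_endpoint (h s) = c s" if s: "s \<in> {0..1}" for s
  proof -
    have "\<exists>i\<le>n. s \<in> {t i..t (Suc i)}"
    proof -
      have "\<exists>i\<le>m. s \<in> {t i..t (Suc i)}" if "s \<le> t (Suc m)" for m
        using that
      proof (induction m)
        case 0
        then show ?case using s t(1) by auto
      next
        case (Suc m)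
        then show ?case by (cases "s \<le> t (Suc m)") (auto intro: le_SucI)
      qed
      then show ?thesis using s t(2) by auto
    qed
    then obtain i where i: "i \<le> n" "s \<in> {t i..t (Suc i)}" by blast
    then have "c s \<in> mball_of X (last (?\<alpha> i)) \<epsilon>"
      using t(4)[OF i(1)] last_\<alpha>[of i] by (metis image_subset_iff le_SucI)
    then have "eps_chain X \<epsilon> (?\<alpha> i @ [c s])" using \<alpha> by (intro eps_chain_snoc) auto
    then show ?thesis using h(2)[OF i] by (simp add: \<gamma>_def eps_endpoint_class)
  qed
  then show ?thesis using h(1) h0 h1 t by (intro exI[of _ h]) (auto simp: pathin_def)
qed

text \<open>Every class is joined to \<open>base\<close> by the lift of a stringing of one of its
  chains. Connectedness is what lets lifts defined on this space be compared at a single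
  point.\<close>

lemma connected_space_C:
  assumes "geodesic_space X"
  shows "connected_space C"
  unfolding connected_space_subconnected
proof (intro ballI)
  have *: "\<exists>S. connectedin C S \<and> base \<in> S \<and> A \<in> S" if "A \<in> topspace C" for A
  proof -
    have "A \<in> P" using that by simp
    then obtain a where a: "A = cls a" "eps_chain X \<epsilon> a" "hd a = x0"
      by (rule P_cases)
    then obtain c where "stringing X \<epsilon> a c" using stringing_exists[OF assms] by blast
    then obtain h where h: "pathin C h" "h 0 = base" "h 1 = A"
      using stringing_lift a by metis
    have "connectedin C (h ` {0..1})"
      using h(1) by (rule connectedin_path_image)
    moreover have "h 0 \<in> h ` {0..1}" "h 1 \<in> h ` {0..1}" by auto
    ultimately show ?thesis using h by metis
  qed
  fix A B assume "A \<in> topspace C" "B \<in> topspace C"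
  then obtain S T where "connectedin C S" "base \<in> S" "A \<in> S" "connectedin C T" "base \<in> T" "B \<in> T"
    using * by metis
  then show "\<exists>S. connectedin C S \<and> A \<in> S \<and> B \<in> S"
    using connectedin_Un[of C S T] by (intro exI[of _ "S \<union> T"]) auto
qed

end

section \<open>Coverings below the space of \<open>\<epsilon>\<close>-chain classes\<close>

locale intermediate_covering = pointed_scale X x0 \<epsilon>
  for X :: "'a metric" and x0 :: 'a and \<epsilon> :: real +
  fixes Y :: "'b metric" and y0 :: 'b and f :: "'b \<Rightarrow> 'a" and g :: "'a list set \<Rightarrow> 'b"
  assumes geodesic: "geodesic_space X"
    and f: "covering_map (mtopology_of Y) (mtopology_of X) f"
    and g: "covering_map C (mtopology_of Y) g" and g_base: "g base = y0"
    and fg: "A \<in> P \<Longrightarrow> eps_endpoint A = f (g A)"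
begin

text \<open>This is \<open>K\<close> described without stringings. Since
  \<open>act D base = D\<close>, the condition says that \<open>D\<close> moves \<open>base\<close>
  within its fibre of \<open>g\<close>; it will turn out equivalent to \<open>g\<close> being
  invariant under \<open>act D\<close>.\<close>

definition stab :: "'a list set set" where
  "stab = {D \<in> carrier G. g D = y0}"

lemma stabD: "D \<in> stab \<Longrightarrow> D \<in> carrier G"
  by (simp add: stab_def)

lemma continuous_g: "continuous_map C (mtopology_of Y) g"
  using g by (simp add: covering_map_def)

lemma g_image: "g ` P = mspace Y"
  using g by (simp add: covering_map_def)

lemma quotient_g: "quotient_map C (mtopology_of Y) g"
  using g by (rule covering_map_quotient_map)

lemma lifts_agree:
  assumes "continuous_map C (mtopology_of Y) h" "continuous_map C (mtopology_of Y) k"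
    and "\<And>A. A \<in> P \<Longrightarrow> f (h A) = f (k A)" and "B \<in> P" "h B = k B" and "A \<in> P"
  shows "h A = k A"
  using covering_map_lift_unique[OF f connected_space_C[OF geodesic] assms(1,2), of B A] assms
  by auto

section \<open>Lifting as a loop, in terms of \<open>g\<close>\<close>

text \<open>If \<open>h\<close> lifts the stringing to the space of chain classes, then
  \<open>g \<circ> h\<close> is its lift to \<open>Y\<close> starting at \<open>y0\<close>, and it
  ends at \<open>g (cls \<kappa>)\<close>. By uniqueness any lift that is a loop at
  \<open>y0\<close> has this endpoint.\<close>

lemma lifts_as_loop_iff:
  assumes \<kappa>: "eps_chain X \<epsilon> \<kappa>" "hd \<kappa> = x0" and c: "stringing X \<epsilon> \<kappa> c"
  shows "lifts_as_loop Y y0 f c \<longleftrightarrow> g (cls \<kappa>) = y0"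
proof -
  obtain h where h: "pathin C h" "h 0 = base" "h 1 = cls \<kappa>"
      "\<And>s. s \<in> {0..1} \<Longrightarrow> eps_endpoint (h s) = c s"
    using stringing_lift[OF assms] by blast
  have hP: "h s \<in> P" if "s \<in> {0..1}" for s
    using h(1) that by (auto simp: pathin_def continuous_map_def)
  have gh: "pathin (mtopology_of Y) (g \<circ> h)"
    using h(1) continuous_g unfolding pathin_def by (rule continuous_map_compose)
  have fgh: "f ((g \<circ> h) s) = c s" if "s \<in> {0..1}" for s
    using h(4)[OF that] fg[OF hP[OF that]] by simp
  show ?thesis
  proof
    assume "lifts_as_loop Y y0 f c"
    then obtain c' where c': "pathin (mtopology_of Y) c'" "c' 0 = y0" "c' 1 = y0"
        "\<And>s. s \<in> {0..1} \<Longrightarrow> f (c' s) = c s"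
      by (auto simp: lifts_as_loop_def)
    have "(g \<circ> h) 1 = c' 1"
    proof (rule covering_map_lift_unique[OF f _ gh[unfolded pathin_def] c'(1)[unfolded pathin_def],
          where ?z0.0 = 0 and z = 1])
      show "connected_space (top_of_set {0..1::real})"
        by (simp add: connected_space_subtopology connectedin_iff_connected)
    qed (use fgh c' h g_base in auto)
    then show "g (cls \<kappa>) = y0" using c'(3) h(3) by simp
  next
    assume "g (cls \<kappa>) = y0"
    then show "lifts_as_loop Y y0 f c"
      unfolding lifts_as_loop_def using gh fgh h g_base by (intro exI[of _ "g \<circ> h"]) auto
  qed
qed

lemma in_class_G:
  assumes "A \<in> carrier G" "\<kappa> \<in> A"
  shows "eps_chain X \<epsilon> \<kappa>" "hd \<kappa> = x0" "A = cls \<kappa>"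
proof -
  obtain a where a: "A = cls a" "eps_chain X \<epsilon> a" "hd a = x0"
    using assms(1) by (rule G_cases)
  have "\<kappa> \<in> cls a" using assms(2) a(1) by simp
  from in_eps_classD[OF this a(2)] show "eps_chain X \<epsilon> \<kappa>" "hd \<kappa> = x0" "A = cls \<kappa>"
    using a eps_class_eq by metis+
qed

text \<open>Existence of stringings supplies the witness when \<open>g A = y0\<close>; the converse
  is \<open>lifts_as_loop_iff\<close>, applicable to any representative of the class.\<close>

lemma stab_eq_some:
  "stab = {A \<in> carrier G. \<exists>\<kappa>\<in>A. \<exists>c. stringing X \<epsilon> \<kappa> c \<and> lifts_as_loop Y y0 f c}"
proof -
  have "g A = y0 \<longleftrightarrow> (\<exists>\<kappa>\<in>A. \<exists>c. stringing X \<epsilon> \<kappa> c \<and> lifts_as_loop Y y0 f c)"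
    if A: "A \<in> carrier G" for A
  proof
    assume "g A = y0"
    obtain a where a: "A = cls a" "eps_chain X \<epsilon> a" "hd a = x0" using A by (rule G_cases)
    then obtain c where "stringing X \<epsilon> a c" using stringing_exists[OF geodesic] by blast
    then show "\<exists>\<kappa>\<in>A. \<exists>c. stringing X \<epsilon> \<kappa> c \<and> lifts_as_loop Y y0 f c"
      using a \<open>g A = y0\<close> lifts_as_loop_iff eps_class_self by blast
  next
    assume "\<exists>\<kappa>\<in>A. \<exists>c. stringing X \<epsilon> \<kappa> c \<and> lifts_as_loop Y y0 f c"
    then show "g A = y0" using in_class_G[OF A] lifts_as_loop_iff by metis
  qed
  then show ?thesis by (auto simp: stab_def)
qed

text \<open>Here existence of stringings keeps the universal condition from being vacuous.\<close>

lemma stab_eq_all: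
  "stab = {A \<in> carrier G. \<forall>\<kappa>\<in>A. \<forall>c. stringing X \<epsilon> \<kappa> c \<longrightarrow> lifts_as_loop Y y0 f c}"
proof -
  have "g A = y0 \<longleftrightarrow> (\<forall>\<kappa>\<in>A. \<forall>c. stringing X \<epsilon> \<kappa> c \<longrightarrow> lifts_as_loop Y y0 f c)"
    if A: "A \<in> carrier G" for A
  proof
    assume "g A = y0"
    then show "\<forall>\<kappa>\<in>A. \<forall>c. stringing X \<epsilon> \<kappa> c \<longrightarrow> lifts_as_loop Y y0 f c"
      using in_class_G[OF A] lifts_as_loop_iff by metis
  next
    assume all: "\<forall>\<kappa>\<in>A. \<forall>c. stringing X \<epsilon> \<kappa> c \<longrightarrow> lifts_as_loop Y y0 f c"
    obtain a where a: "A = cls a" "eps_chain X \<epsilon> a" "hd a = x0" using A by (rule G_cases)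
    then obtain c where "stringing X \<epsilon> a c" using stringing_exists[OF geodesic] by blast
    then show "g A = y0" using all a lifts_as_loop_iff eps_class_self by blast
  qed
  then show ?thesis by (auto simp: stab_def)
qed

section \<open>Invariance of \<open>g\<close> under \<open>stab\<close>\<close>

text \<open>Both \<open>g \<circ> act D\<close> and \<open>g\<close> lift the endpoint map along
  \<open>f\<close>, so agreement at \<open>B\<close> spreads to all of \<open>P\<close>.\<close>

lemma g_act_eqI:
  assumes D: "D \<in> carrier G" and B: "B \<in> P" "g (act D B) = g B" and A: "A \<in> P"
  shows "g (act D A) = g A"
proof -
  have "continuous_map C (mtopology_of Y) (g \<circ> act D)"
    using continuous_map_act[OF D] continuous_g by (rule continuous_map_compose)
  moreover have "f ((g \<circ> act D) E) = f (g E)" if "E \<in> P" for E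
    using act_in_P[OF D that] fg that by simp
  ultimately have "(g \<circ> act D) A = g A"
    using lifts_agree[OF _ continuous_g _ B(1) _ A] B(2) by simp
  then show ?thesis by simp
qed

lemma stab_act: "D \<in> stab \<Longrightarrow> A \<in> P \<Longrightarrow> g (act D A) = g A"
  using g_act_eqI[OF _ base_in_P] act_base_right g_base by (simp add: stab_def)

text \<open>Agreement at an arbitrary point \<open>B\<close> is transported to \<open>base\<close>,
  where it is membership in \<open>stab\<close>.\<close>

lemma stabI:
  assumes "D \<in> carrier G" "B \<in> P" "g (act D B) = g B"
  shows "D \<in> stab"
  using g_act_eqI[OF assms base_in_P] assms(1) act_base_right g_base by (simp add: stab_def)

lemma subgroup_stab: "subgroup stab G"
proof (rule G.subgroupI)
  show "stab \<subseteq> carrier G" by (auto simp: stab_def)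
  show "stab \<noteq> {}" using G.one_closed g_base by (auto simp: stab_def one_G)
next
  fix D assume D: "D \<in> stab"
  then have "inv\<^bsub>G\<^esub> D \<in> carrier G" "D \<in> P" using stabD G_subset_P by auto
  \<comment> \<open>The criterion \<open>stabI\<close> is used at the point \<open>D\<close>: the
    inverse sends it to \<open>base\<close>, and \<open>g\<close> has the value \<open>y0\<close> at
    both.\<close>
  moreover have "act (inv\<^bsub>G\<^esub> D) D = base"
    using stabD[OF D] G.l_inv[of D] by (simp add: mult_G one_G)
  ultimately show "inv\<^bsub>G\<^esub> D \<in> stab"
    using D g_base by (intro stabI[of _ D]) (auto simp: stab_def)
next
  fix D E assume "D \<in> stab" "E \<in> stab"
  then show "D \<otimes>\<^bsub>G\<^esub> E \<in> stab"
    using stab_act[of D E] G.m_closed[of D E] G_subset_P by (auto simp: stab_def mult_G)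
qed

section \<open>Fibres of \<open>g\<close> and orbits of \<open>stab\<close>\<close>

lemma g_eq_act:
  assumes "A \<in> P" "B \<in> P" "g A = g B"
  shows "\<exists>D\<in>carrier G. act D B = A"
  using assms fg[of A] fg[of B] by (intro act_transitive) simp_all

text \<open>Points in one fibre of \<open>g\<close> have the same endpoint, so some \<open>D\<close>
  in the group carries one to the other; agreement of \<open>g\<close> at this one pair already puts
  \<open>D\<close> in \<open>stab\<close>.\<close>

lemma eps_orbit_eq_iff:
  assumes A: "A \<in> P" and B: "B \<in> P"
  shows "eps_orbit X \<epsilon> stab A = eps_orbit X \<epsilon> stab B \<longleftrightarrow> g A = g B"
proof
  assume "eps_orbit X \<epsilon> stab A = eps_orbit X \<epsilon> stab B"
  moreover have "A \<in> eps_orbit X \<epsilon> stab A"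
    using subgroup.one_closed[OF subgroup_stab] act_base_left[OF A]
    unfolding eps_orbit_def one_G by force
  ultimately have "A \<in> eps_orbit X \<epsilon> stab B" by simp
  then obtain D where "D \<in> stab" "A = act D B" by (auto simp: eps_orbit_def)
  then show "g A = g B" using stab_act B by simp
next
  have sub: "eps_orbit X \<epsilon> stab A \<subseteq> eps_orbit X \<epsilon> stab B"
    if AB: "A \<in> P" "B \<in> P" "g A = g B" for A B
  proof -
    obtain D where D: "D \<in> carrier G" "act D B = A"
      using g_eq_act[OF AB] by blast
    then have "D \<in> stab" using stabI[OF D(1) AB(2)] AB(3) by simp
    have "act E A \<in> eps_orbit X \<epsilon> stab B" if "E \<in> stab" for E
    proof -
      have "act E D \<in> stab"
        using subgroup.m_closed[OF subgroup_stab \<open>E \<in> stab\<close> \<open>D \<in> stab\<close>] by (simp add: mult_G)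
      moreover have "act E A = act (act E D) B"
        using act_assoc[OF stabD[OF \<open>E \<in> stab\<close>] D(1) AB(2)] D(2) by simp
      ultimately show ?thesis by (simp add: eps_orbit_def)
    qed
    then show ?thesis by (auto simp: eps_orbit_def)
  qed
  assume "g A = g B"
  then show "eps_orbit X \<epsilon> stab A = eps_orbit X \<epsilon> stab B"
    using sub[OF A B] sub[OF B A] by auto
qed

lemma orbit_endpoint_orbit:
  assumes A: "A \<in> P"
  shows "orbit_endpoint (eps_orbit X \<epsilon> stab A) = eps_endpoint A"
  unfolding orbit_endpoint_def
proof (rule the_equality)
  show "\<forall>B\<in>eps_orbit X \<epsilon> stab A. eps_endpoint B = eps_endpoint A"
    using act_in_P(2) A stabD by (auto simp: eps_orbit_def)
  \<comment> \<open>The orbit contains \<open>A\<close>, so the common endpoint is unique.\<close>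
  have "act base A \<in> eps_orbit X \<epsilon> stab A"
    using subgroup.one_closed[OF subgroup_stab] by (auto simp: eps_orbit_def one_G)
  then show "x = eps_endpoint A" if "\<forall>B\<in>eps_orbit X \<epsilon> stab A. eps_endpoint B = x" for x
    using that act_base_left[OF A] by auto
qed

text \<open>Both \<open>g\<close> and the orbit map are quotient maps on the same space with the
  same fibres, so the induced bijection of their targets is a homeomorphism.\<close>

lemma orbit_equivalence:
  "\<exists>\<phi>. covering_equivalence (mtopology_of Y) f (eps_orbit_topology X x0 \<epsilon> stab) orbit_endpoint \<phi>
     \<and> (\<forall>A\<in>P. eps_orbit X \<epsilon> stab A = \<phi> (g A))"
proof -
  let ?T = "eps_orbit_topology X x0 \<epsilon> stab" and ?q = "eps_orbit X \<epsilon> stab"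
  have q: "quotient_map C ?T ?q"
    unfolding eps_orbit_topology_def by (rule quotient_map_quotient_topology)
  have "\<exists>\<phi>. \<forall>A\<in>P. \<phi> (g A) = ?q A"
  proof (rule quotient_map_lift_exists[OF quotient_g quotient_imp_continuous_map[OF q]])
    show "?q A = ?q B" if "A \<in> topspace C" "B \<in> topspace C" "g A = g B" for A B
      using eps_orbit_eq_iff that by simp
    show "\<exists>\<phi>. \<forall>A\<in>P. \<phi> (g A) = ?q A" if "\<And>A. A \<in> topspace C \<Longrightarrow> k (g A) = ?q A" for k
      using that by (intro exI[of _ k]) simp
  qed
  then obtain \<phi> where \<phi>: "\<And>A. A \<in> P \<Longrightarrow> \<phi> (g A) = ?q A" by blast
  \<comment> \<open>Since \<open>g\<close> and \<open>\<phi> \<circ> g\<close> are quotient maps, so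
    is \<open>\<phi>\<close>; an injective quotient map is a homeomorphism.\<close>
  have "quotient_map C ?T (\<phi> \<circ> g)"
    using q \<phi> by (auto intro: quotient_map_eq)
  then have "quotient_map (mtopology_of Y) ?T \<phi>"
    using quotient_map_compose_eq[OF quotient_g] by blast
  moreover have "inj_on \<phi> (mspace Y)"
    unfolding g_image[symmetric] using \<phi> eps_orbit_eq_iff by (auto simp: inj_on_def)
  moreover have "orbit_endpoint (\<phi> y) = f y" if "y \<in> mspace Y" for y
    using that \<phi> fg orbit_endpoint_orbit unfolding g_image[symmetric] by auto
  ultimately show ?thesis
    using \<phi> by (intro exI[of _ \<phi>]) (simp add: covering_equivalence_def homeomorphic_map_def)
qed

section \<open>Normality and regularity\<close>

text \<open>If \<open>A\<close> is the translate of \<open>B\<close> by \<open>E\<close> in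
  \<open>stab\<close>, then \<open>act D A\<close> is the translate of \<open>act D B\<close> by the
  conjugate of \<open>E\<close> by \<open>D\<close>. Normality keeps that conjugate in
  \<open>stab\<close>, so \<open>g \<circ> act D\<close> is constant on the fibres of
  \<open>g\<close>.\<close>

lemma act_descends:
  assumes N: "stab \<lhd> G" and D: "D \<in> carrier G"
  shows "\<exists>h. continuous_map (mtopology_of Y) (mtopology_of Y) h \<and> (\<forall>A\<in>P. h (g A) = g (act D A))"
proof -
  have cont: "continuous_map C (mtopology_of Y) (g \<circ> act D)"
    using continuous_map_act[OF D] continuous_g by (rule continuous_map_compose)
  have eq: "(g \<circ> act D) A = (g \<circ> act D) B" if AB: "A \<in> P" "B \<in> P" "g A = g B" for A B
  proof -
    obtain E where E: "E \<in> carrier G" "act E B = A"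
      using g_eq_act[OF AB] by blast
    then have "E \<in> stab" using stabI[OF E(1) AB(2)] AB(3) by simp
    then have "D \<otimes>\<^bsub>G\<^esub> E \<otimes>\<^bsub>G\<^esub> inv\<^bsub>G\<^esub> D \<in> stab"
      using G.normal_invE(2)[OF N D] by blast
    then have "g (act (act (act D E) (inv\<^bsub>G\<^esub> D)) (act D B)) = g (act D B)"
      using stab_act act_in_P(1)[OF D AB(2)] by (simp add: mult_G)
    also have "act (act (act D E) (inv\<^bsub>G\<^esub> D)) (act D B) = act (act D E) B"
      using D E AB act_in_P(1)[OF D AB(2)] G.m_closed[OF D E(1)] inv_act(1)[OF D AB(2)]
        act_assoc[of "act D E" "inv\<^bsub>G\<^esub> D" "act D B"]
      by (simp add: mult_G)
    also have "\<dots> = act D A" using act_assoc[OF D E(1) AB(2)] E(2) by simp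
    finally show ?thesis by simp
  qed
  show ?thesis
  proof (rule quotient_map_lift_exists[OF quotient_g cont])
    show "(g \<circ> act D) A = (g \<circ> act D) B"
      if "A \<in> topspace C" "B \<in> topspace C" "g A = g B" for A B
      using that by (intro eq) simp_all
    show ?thesis if "continuous_map (mtopology_of Y) (mtopology_of Y) h"
      "\<And>A. A \<in> topspace C \<Longrightarrow> h (g A) = (g \<circ> act D) A" for h
      using that by (intro exI[of _ h]) simp
  qed
qed

text \<open>Two points in a fibre of \<open>f\<close> lift to classes with equal endpoints, and some
  \<open>D\<close> carries one class to the other. The maps of \<open>Y\<close> induced by
  \<open>D\<close> and by its inverse are mutually inverse.\<close>

lemma normal_imp_regular:
  assumes N: "stab \<lhd> G"
  shows "regular_covering_map (mtopology_of Y) (mtopology_of X) f"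
  unfolding regular_covering_map_def
proof (intro conjI ballI impI f)
  fix y z assume yz: "y \<in> topspace (mtopology_of Y)" "z \<in> topspace (mtopology_of Y)" "f y = f z"
  then have "y \<in> g ` P" "z \<in> g ` P" using g_image by simp_all
  then obtain A B where A: "A \<in> P" "y = g A" and B: "B \<in> P" "z = g B" by blast
  have "eps_endpoint B = eps_endpoint A" using fg[OF A(1)] fg[OF B(1)] A(2) B(2) yz(3) by simp
  then obtain D where D: "D \<in> carrier G" "act D A = B"
    using act_transitive[OF B(1) A(1)] \<open>eps_endpoint B = eps_endpoint A\<close> by blast
  obtain h where h: "continuous_map (mtopology_of Y) (mtopology_of Y) h"
    "\<And>A. A \<in> P \<Longrightarrow> h (g A) = g (act D A)" using act_descends[OF N D(1)] by blast
  obtain k where k: "continuous_map (mtopology_of Y) (mtopology_of Y) k"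
    "\<And>A. A \<in> P \<Longrightarrow> k (g A) = g (act (inv\<^bsub>G\<^esub> D) A)"
    using act_descends[OF N G.inv_closed[OF D(1)]] by blast
  have "homeomorphic_maps (mtopology_of Y) (mtopology_of Y) h k"
    using h k D act_in_P(1) inv_act[OF D(1)]
    by (auto simp: homeomorphic_maps_def g_image[symmetric])
  then have "homeomorphic_map (mtopology_of Y) (mtopology_of Y) h"
    by (rule homeomorphic_maps_imp_map)
  moreover have "f (h w) = f w" if "w \<in> mspace Y" for w
    using that h(2) act_in_P[OF D(1)] fg unfolding g_image[symmetric] by force
  ultimately have "deck_transformation (mtopology_of Y) f h"
    by (simp add: deck_transformation_def)
  then show "\<exists>h. deck_transformation (mtopology_of Y) f h \<and> h y = z"
    using h(2)[OF A(1)] A B D by auto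
qed

text \<open>Regularity yields, for each \<open>D\<close>, a deck transformation \<open>h\<close>
  sending \<open>y0\<close> to \<open>g D\<close>. Then \<open>h \<circ> g\<close> and
  \<open>g \<circ> act D\<close> agree at \<open>base\<close>, hence everywhere: \<open>D\<close>
  descends to \<open>h\<close>.\<close>

lemma regular_imp_normal:
  assumes R: "regular_covering_map (mtopology_of Y) (mtopology_of X) f"
  shows "stab \<lhd> G"
  unfolding G.normal_inv_iff
proof (intro conjI ballI subgroup_stab)
  fix D E assume D: "D \<in> carrier G" and E: "E \<in> stab"
  have EG: "E \<in> carrier G" using E by (rule stabD)
  have DP: "D \<in> P" using D by (rule G_subset_P)
  have "eps_endpoint D = x0" using D by (simp add: G_iff)
  then have "f y0 = f (g D)"
    using fg[OF DP] fg[OF base_in_P] g_base eps_endpoint_class[OF chain_x0] by simp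
  moreover have "y0 \<in> mspace Y" "g D \<in> mspace Y"
    using g_base base_in_P DP g_image by auto
  ultimately obtain h where h: "deck_transformation (mtopology_of Y) f h" "h y0 = g D"
    using R by (auto simp: regular_covering_map_def)
  have hc: "continuous_map (mtopology_of Y) (mtopology_of Y) h"
    and fh: "\<And>y. y \<in> mspace Y \<Longrightarrow> f (h y) = f y"
    using h(1) homeomorphic_imp_continuous_map by (auto simp: deck_transformation_def)
  have hg: "h (g A) = g (act D A)" if A: "A \<in> P" for A
  proof -
    have "continuous_map C (mtopology_of Y) (h \<circ> g)"
      using continuous_g hc by (rule continuous_map_compose)
    moreover have "continuous_map C (mtopology_of Y) (g \<circ> act D)"
      using continuous_map_act[OF D] continuous_g by (rule continuous_map_compose)
    moreover have "f ((h \<circ> g) B) = f ((g \<circ> act D) B)" if "B \<in> P" for B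
      using that fh[of "g B"] g_image fg act_in_P[OF D that] by auto
    moreover have "(h \<circ> g) base = (g \<circ> act D) base"
      using g_base h(2) act_base_right[OF D] by simp
    ultimately have "(h \<circ> g) A = (g \<circ> act D) A"
      using lifts_agree[OF _ _ _ base_in_P _ A] by blast
    then show ?thesis by simp
  qed
  let ?D' = "inv\<^bsub>G\<^esub> D"
  have D': "?D' \<in> carrier G" "?D' \<in> P" using D G_subset_P by auto
  have DE: "act D E \<in> carrier G" using G.m_closed[OF D EG] by (simp add: mult_G)
  have ED': "act E ?D' \<in> P" using act_in_P(1)[OF EG D'(2)] .
  \<comment> \<open>The value of \<open>g\<close> at the conjugate is computed by moving
    \<open>D\<close> outside as \<open>h\<close>, dropping \<open>E\<close> because it lies in
    \<open>stab\<close>, and moving \<open>D\<close> back in, where it cancels against its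
    inverse.\<close>
  have "g (act (act D E) ?D') = g (act D (act E ?D'))"
    using act_assoc[OF D EG D'(2)] by simp
  also have "\<dots> = h (g ?D')"
    using hg[OF ED'] stab_act[OF E D'(2)] by simp
  also have "\<dots> = g base"
    using hg[OF D'(2)] G.r_inv[OF D] by (simp add: mult_G one_G)
  finally show "D \<otimes>\<^bsub>G\<^esub> E \<otimes>\<^bsub>G\<^esub> ?D' \<in> stab"
    using G.m_closed[OF DE[folded mult_G] D'(1)] g_base by (simp add: stab_def mult_G)
qed

end

theorem theorem15:
  fixes X :: "'a metric" and Y :: "'b metric" and f :: "'b \<Rightarrow> 'a" and g :: "'a list set \<Rightarrow> 'b"
    and x0 :: 'a and y0 :: 'b and \<epsilon> :: real and K :: "'a list set set"
  assumes X: "compact_space (mtopology_of X)" "geodesic_space X" "x0 \<in> mspace X"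
    and f: "covering_map (mtopology_of Y) (mtopology_of X) f" "y0 \<in> mspace Y" "f y0 = x0"
    and Y: "connected_space (mtopology_of Y)" "lifted_geodesic_metric Y X f"
    and \<epsilon>: "\<epsilon> > 0"
    and g: "covering_map (mtopology_of (eps_space X x0 \<epsilon>)) (mtopology_of Y) g"
      "g (eps_class X \<epsilon> [x0]) = y0"
    and fg: "\<And>A. A \<in> eps_points X x0 \<epsilon> \<Longrightarrow> eps_endpoint A = f (g A)"
    and K: "K = {A \<in> carrier (eps_group X x0 \<epsilon>).
      \<exists>\<kappa>\<in>A. \<exists>c. stringing X \<epsilon> \<kappa> c \<and> lifts_as_loop Y y0 f c}"
  shows "subgroup K (eps_group X x0 \<epsilon>)
    \<and> K = {A \<in> carrier (eps_group X x0 \<epsilon>).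
        \<forall>\<kappa>\<in>A. \<forall>c. stringing X \<epsilon> \<kappa> c \<longrightarrow> lifts_as_loop Y y0 f c}
    \<and> (\<exists>\<phi>. covering_equivalence (mtopology_of Y) f
               (eps_orbit_topology X x0 \<epsilon> K) orbit_endpoint \<phi>
            \<and> (\<forall>A\<in>eps_points X x0 \<epsilon>. eps_orbit X \<epsilon> K A = \<phi> (g A)))
    \<and> (K \<lhd> eps_group X x0 \<epsilon> \<longleftrightarrow> regular_covering_map (mtopology_of Y) (mtopology_of X) f)"
proof -
  interpret intermediate_covering X x0 \<epsilon> Y y0 f g
    using X(2,3) f(1) \<epsilon> g fg by unfold_locales
  have "K = stab" using K stab_eq_some by simp
  then show ?thesis
    using subgroup_stab stab_eq_all orbit_equivalence normal_imp_regular regular_imp_normal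
    by blast
qed

end
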